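(* Let $f\in\mathbb{Q}[x]$ be a polynomial of degree at least $3$ without multiple roots, let $m\geq 3$ be an odd integer, and let $b,c\in\mathbb{Z}\setminus\{0\}$. Consider the curves $C_{1}:\ y^2=f(x)$, $C_{2}:\ y^2=x^m+b$, $C_{3}:\ y^2=x^m+c$. Then there exists a rational function $D\in\mathbb{Q}(u,v,w)$ such that the Jacobians of the three curves $$D\,y^2=f(x),\qquad y^2=x^m+bD,\qquad y^2=x^m+cD$$ (the quadratic twist of $C_1$ by $D$ and the $2m$-twists of $C_2,C_3$ by $D$) all have positive rank over $\mathbb{Q}(u,v,w)$.
   Context: $u,v,w$ are independent indeterminates. Jacobians are those of the smooth projective models over $\mathbb{Q}(u,v,w)$; "positive rank" means the group of $\mathbb{Q}(u,v,w)$-rational points of the Jacobian contains a point of infinite order. *)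

theory Defs
  imports "HOL-Algebra.Coset" "HOL-Algebra.Algebraic_Closure_Type"
begin

text \<open>
  \<open>ratfun3\<close> is the field Q(u,v,w), as the fraction field of Q[u][v][w].

  For a field \<open>'k\<close> of characteristic 0 with algebraic closure \<open>'k alg_closure\<close>, the type
  \<open>'k ff_closure\<close> is an algebraic closure of the field of rational functions in \<open>x\<close> over
  \<open>'k alg_closure\<close>. Function fields of plane curves over \<open>'k alg_closure\<close> are realised inside it.
\<close>

type_synonym ratfun3 = "rat poly poly poly fract"

type_synonym 'k ff_closure = "'k alg_closure poly fract alg_closure"

definition ff_const :: "'k::field_char_0 alg_closure \<Rightarrow> 'k ff_closure" where
  "ff_const c = to_ac (to_fract [:c:])"

definition ff_x :: "'k::field_char_0 ff_closure" where
  "ff_x = to_ac (to_fract [:0, 1:])"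

text \<open>
  A plane affine curve over \<open>'k\<close> is given by a polynomial \<open>\<Phi>\<close> in \<open>y\<close> with coefficients in
  \<open>'k[x]\<close>. In the following \<open>\<Phi>\<close> is meant to be irreducible over the algebraic closure of \<open>'k\<close> and of
  positive degree in \<open>y\<close>. Its roots in \<open>'k ff_closure\<close> are then conjugate over the rational
  functions in \<open>x\<close>, so that the choice of the root in \<open>ff_y\<close> is immaterial.
\<close>

definition ff_y :: "'k::field_char_0 poly poly \<Rightarrow> 'k ff_closure" where
  "ff_y \<Phi> = (SOME y. poly (map_poly (\<lambda>p. to_ac (to_fract (map_poly to_ac p))) \<Phi>) y = 0)"

text \<open>
  The function field of the curve over the algebraic closure: since \<open>ff_y \<Phi>\<close> is algebraic over
  the rational functions in \<open>x\<close>, the field it generates over them consists of the polynomials in it.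
\<close>

definition fun_field :: "'k::field_char_0 poly poly \<Rightarrow> 'k ff_closure set" where
  "fun_field \<Phi> = range (\<lambda>g. poly (map_poly to_ac g) (ff_y \<Phi>))"

text \<open>
  The points of the smooth projective model over the algebraic closure, each encoded by its order of
  vanishing: they correspond bijectively to the normalised discrete valuations of the function
  field that are trivial on the constants. The value 0 outside the nonzero elements of the function
  field is a convention that makes the function representing a point unique.
\<close>

definition curve_points :: "'k::field_char_0 poly poly \<Rightarrow> ('k ff_closure \<Rightarrow> int) set" where
  "curve_points \<Phi> = {v.
     (\<forall>h. h \<notin> fun_field \<Phi> - {0} \<longrightarrow> v h = 0) \<and>
     (\<forall>g\<in>fun_field \<Phi> - {0}. \<forall>h\<in>fun_field \<Phi> - {0}. v (g * h) = v g + v h) \<and>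
     (\<forall>g\<in>fun_field \<Phi> - {0}. \<forall>h\<in>fun_field \<Phi> - {0}.
        g + h \<noteq> 0 \<longrightarrow> v (g + h) \<ge> min (v g) (v h)) \<and>
     (\<forall>c. v (ff_const c) = 0) \<and>
     (\<exists>h\<in>fun_field \<Phi>. v h = 1)}"

type_synonym 'k divisor = "('k ff_closure \<Rightarrow> int) \<Rightarrow> int"

definition div0_group :: "'k::field_char_0 poly poly \<Rightarrow> 'k divisor monoid" where
  "div0_group \<Phi> = \<lparr>
     carrier = {A. finite {v. A v \<noteq> 0} \<and> {v. A v \<noteq> 0} \<subseteq> curve_points \<Phi> \<and>
                   (\<Sum>v | A v \<noteq> 0. A v) = 0},
     monoid.mult = (\<lambda>A B v. A v + B v),
     one = (\<lambda>v. 0)\<rparr>"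

definition principal_divisor ::
    "'k::field_char_0 poly poly \<Rightarrow> 'k ff_closure \<Rightarrow> 'k divisor" where
  "principal_divisor \<Phi> h = (\<lambda>v. if v \<in> curve_points \<Phi> then v h else 0)"

definition pic0_group :: "'k::field_char_0 poly poly \<Rightarrow> 'k divisor set monoid" where
  "pic0_group \<Phi> = div0_group \<Phi> Mod (principal_divisor \<Phi> ` (fun_field \<Phi> - {0}))"

definition absolute_galois :: "('k::field_char_0 alg_closure \<Rightarrow> 'k alg_closure) set" where
  "absolute_galois = {\<sigma>. bij \<sigma> \<and> (\<forall>a b. \<sigma> (a + b) = \<sigma> a + \<sigma> b) \<and>
     (\<forall>a b. \<sigma> (a * b) = \<sigma> a * \<sigma> b) \<and> (\<forall>c. \<sigma> (to_ac c) = to_ac c)}"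

text \<open>
  The action of the absolute Galois group of \<open>'k\<close> on the function field, through the
  constants and with the coordinate functions \<open>x\<close> and \<open>y\<close> fixed.
\<close>

definition galois_lifts ::
    "'k::field_char_0 poly poly \<Rightarrow> ('k ff_closure \<Rightarrow> 'k ff_closure) set" where
  "galois_lifts \<Phi> = {\<tau>. bij_betw \<tau> (fun_field \<Phi>) (fun_field \<Phi>) \<and>
     (\<forall>g\<in>fun_field \<Phi>. \<forall>h\<in>fun_field \<Phi>. \<tau> (g + h) = \<tau> g + \<tau> h \<and> \<tau> (g * h) = \<tau> g * \<tau> h) \<and>
     \<tau> ff_x = ff_x \<and> \<tau> (ff_y \<Phi>) = ff_y \<Phi> \<and>
     (\<exists>\<sigma>\<in>absolute_galois. \<forall>c. \<tau> (ff_const c) = ff_const (\<sigma> c))}"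

definition act_point :: "'k::field_char_0 poly poly \<Rightarrow> ('k ff_closure \<Rightarrow> 'k ff_closure) \<Rightarrow>
    ('k ff_closure \<Rightarrow> int) \<Rightarrow> ('k ff_closure \<Rightarrow> int)" where
  "act_point \<Phi> \<tau> v = (\<lambda>h. if h \<in> fun_field \<Phi> then v (\<tau> h) else 0)"

definition act_divisor :: "'k::field_char_0 poly poly \<Rightarrow> ('k ff_closure \<Rightarrow> 'k ff_closure) \<Rightarrow>
    'k divisor \<Rightarrow> 'k divisor" where
  "act_divisor \<Phi> \<tau> A = (\<lambda>v. if v \<in> curve_points \<Phi> then A (act_point \<Phi> \<tau> v) else 0)"

text \<open>
  The group of \<open>'k\<close>-rational points of the Jacobian of the smooth projective model: the
  Galois-invariant classes of degree 0 over the algebraic closure. Such a class need not contain a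
  divisor that is itself Galois-invariant, as the curve may have no \<open>'k\<close>-rational point.
\<close>

definition jacobian_points :: "'k::field_char_0 poly poly \<Rightarrow> 'k divisor set monoid" where
  "jacobian_points \<Phi> = (pic0_group \<Phi>)\<lparr>carrier :=
     {Z \<in> carrier (pic0_group \<Phi>). \<forall>\<tau>\<in>galois_lifts \<Phi>. act_divisor \<Phi> \<tau> ` Z = Z}\<rparr>"

definition positive_rank :: "('a, 'b) monoid_scheme \<Rightarrow> bool" where
  "positive_rank G \<longleftrightarrow> (\<exists>P\<in>carrier G. \<forall>n::nat. n > 0 \<longrightarrow> P [^]\<^bsub>G\<^esub> n \<noteq> \<one>\<^bsub>G\<^esub>)"

text \<open>The curve \<open>a y\<^sup>2 = g(x)\<close>, as the polynomial \<open>a y\<^sup>2 - g(x)\<close> in \<open>y\<close>.\<close>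

definition square_curve :: "'k::field_char_0 \<Rightarrow> 'k poly \<Rightarrow> 'k poly poly" where
  "square_curve a g = [:- g, 0, [:a:]:]"

end

theory Submission
  imports Defs
begin

text \<open>
  Let \<open>P = (x\<^sub>0, y\<^sub>0)\<close> be a rational point of \<open>y\<^sup>2 = g(x)\<close> with \<open>y\<^sub>0 \<noteq> 0\<close>, and let \<open>P'\<close> be its conjugate.
  If \<open>n (P - P')\<close> is the divisor of \<open>h\<close>, then \<open>(x - x\<^sub>0)\<^sup>n h = A + B y\<close> with polynomials \<open>A\<close>, \<open>B\<close>
  such that \<open>A\<^sup>2 - g B\<^sup>2 = c (x - x\<^sub>0)\<^bsup>2n\<^esup>\<close>, \<open>deg A \<le> n\<close> and \<open>2 deg B + deg g \<le> 2n\<close>. Vanishing of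
  \<open>A + B y\<close> at \<open>P\<close> to order \<open>2n\<close> is a linear condition on \<open>A\<close> and \<open>B\<close> over the ground field, so a
  solution over the algebraic closure yields one over the ground field.

  Suppose the ground field has a derivation that extends to \<open>\<delta>\<close> on the function field with
  \<open>\<delta> x = \<lambda> x\<close> and \<open>\<delta> y = \<mu> y\<close>. Then \<open>\<delta>(A + B y) / (A + B y)\<close> has at most a simple pole at \<open>P\<close>, and
  the degree bounds together with \<open>deg g \<ge> 3\<close> force its \<open>y\<close>-part to vanish. Regularity at \<open>P'\<close> then
  gives \<open>\<delta> x\<^sub>0 = \<lambda> x\<^sub>0\<close>. So \<open>P - P'\<close> has infinite order if \<open>\<delta> x\<^sub>0 \<noteq> \<lambda> x\<^sub>0\<close>. Both \<open>y\<^sup>2 = f(x) / D\<close>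
  and \<open>y\<^sup>2 = x\<^sup>m + b D\<close> admit such a \<open>\<delta>\<close>, and it remains to find \<open>D\<close> with points on all three twists.
\<close>

section \<open>The Pell equation\<close>

text \<open>The clause \<open>B \<noteq> 0\<close> removes the trivial solutions
  \<open>A = a (x - x0)^n\<close>, which come from constant functions. The degree bounds say that
  neither \<open>A\<close> nor \<open>B y\<close> has a worse pole at infinity than
  \<open>(x - x0)^n\<close>.\<close>

definition pell_solution :: "'a::field poly \<Rightarrow> 'a \<Rightarrow> nat \<Rightarrow> 'a poly \<Rightarrow> 'a poly \<Rightarrow> bool" where
  "pell_solution g x0 n A B \<longleftrightarrow> B \<noteq> 0 \<and> Polynomial.degree A \<le> n \<and>
     2 * Polynomial.degree B + Polynomial.degree g \<le> 2 * n \<and>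
     (\<exists>c. c \<noteq> 0 \<and> A\<^sup>2 - g * B\<^sup>2 = Polynomial.smult c ([:- x0, 1:] ^ (2 * n)))"

lemma linear_power_dvd_cancel:
  fixes A C :: "'a::field poly"
  assumes "[:- x0, 1:] ^ k dvd A * C" and "poly A x0 \<noteq> 0"
  shows "[:- x0, 1:] ^ k dvd C"
proof (cases "C = 0")
  case False
  moreover have "A \<noteq> 0"
    using assms(2) by auto
  ultimately have "A * C \<noteq> 0"
    by simp
  then have "k \<le> Polynomial.order x0 (A * C)"
    using assms(1) by (simp add: order_divides)
  also have "\<dots> = Polynomial.order x0 C"
    using \<open>A * C \<noteq> 0\<close> assms(2) by (simp add: order_mult order_0I)
  finally show ?thesis
    by (simp add: order_divides)
qed simp

lemma pell_no_solution_derivation: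
  fixes \<delta> :: "'a::field_char_0 poly \<Rightarrow> 'a poly"
  assumes add: "\<And>p q. \<delta> (p + q) = \<delta> p + \<delta> q"
    and leibniz: "\<And>p q. \<delta> (p * q) = \<delta> p * q + p * \<delta> q"
    and deg: "\<And>p. Polynomial.degree (\<delta> p) \<le> Polynomial.degree p"
    and g: "\<delta> g = Polynomial.smult (2 * \<mu>) g" "Polynomial.degree g \<ge> 3"
    and x0: "poly (\<delta> [:- x0, 1:]) x0 \<noteq> 0"
    and sol: "pell_solution g x0 n A B" and A: "poly A x0 \<noteq> 0"
  shows False
proof -
  obtain c where c: "c \<noteq> 0" "A\<^sup>2 - g * B\<^sup>2 = Polynomial.smult c ([:- x0, 1:] ^ (2 * n))"
    and dA: "Polynomial.degree A \<le> n" and dB: "2 * Polynomial.degree B + Polynomial.degree g \<le> 2 * n"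
    using sol unfolding pell_solution_def by auto
  define t where "t = [:- x0, 1:]"
  \<comment> \<open>\<open>B'\<close> is the coefficient of \<open>y\<close> in
    \<open>\<delta> (A + B y)\<close>, where \<open>\<delta> y = \<mu> y\<close>. Multiplying this
    derivative by the conjugate \<open>A - B y\<close> gives \<open>R + C y\<close>, so
    \<open>R\<close> and \<open>C\<close> are the two parts of the logarithmic derivative, up to the
    norm \<open>c t^(2 n)\<close>.\<close>
  define B' where "B' = \<delta> B + Polynomial.smult \<mu> B"
  define R where "R = A * \<delta> A - g * B * B'"
  define C where "C = A * B' - \<delta> A * B"
  have "n > 0"
    using dB g(2) by simp
  have "t \<noteq> 0"
    by (simp add: t_def)
  have \<delta>_power: "\<delta> (p ^ Suc k) = of_nat (Suc k) * p ^ k * \<delta> p" for p k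
  proof (induction k)
    case (Suc k)
    have "\<delta> (p ^ Suc (Suc k)) = \<delta> p * p ^ Suc k + p * \<delta> (p ^ Suc k)"
      by (simp add: leibniz)
    then show ?case
      by (simp only: Suc.IH) (simp add: algebra_simps)
  qed simp
  have \<delta>_diff: "\<delta> (p - q) = \<delta> p - \<delta> q" for p q
    using add[of "p - q" q] by (simp add: algebra_simps)
  have norm: "A\<^sup>2 - g * B\<^sup>2 = [:c:] * t ^ (2 * n)"
    using c(2) by (simp add: t_def)
  \<comment> \<open>Differentiating \<open>t^(2 n)\<close> costs one factor \<open>t\<close>, hence
    the exponent \<open>k = 2 n - 1\<close>.\<close>
  obtain k where k: "2 * n = Suc k"
    using \<open>n > 0\<close> by (metis Suc_pred mult_pos_pos zero_less_numeral)
  have "2 * R = \<delta> (A\<^sup>2 - g * B\<^sup>2)"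
    by (simp add: R_def B'_def power2_eq_square leibniz \<delta>_diff g(1) algebra_simps
        numeral_poly mult_2[symmetric])
  also have "\<dots> = \<delta> [:c:] * t ^ (2 * n) + [:c:] * (of_nat (2 * n) * t ^ k * \<delta> t)"
    by (simp only: norm leibniz k \<delta>_power)
  finally have R: "2 * R = \<delta> [:c:] * t ^ (2 * n) + [:c:] * (of_nat (2 * n) * t ^ k * \<delta> t)" .
  have "t ^ k dvd t ^ (2 * n)"
    by (simp add: k)
  then have "t ^ k dvd 2 * R"
    unfolding R by (intro dvd_add dvd_mult[of _ "t ^ (2 * n)"] dvd_mult[OF dvd_mult2[OF dvd_mult]]) simp_all
  then have tR: "t ^ k dvd R"
    using dvd_smult_iff[of "2::'a" "t ^ k" R] by (simp add: numeral_poly)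
  have "A * C = A\<^sup>2 * B' - A * \<delta> A * B"
    by (simp add: C_def power2_eq_square algebra_simps)
  also have "\<dots> = [:c:] * t ^ (2 * n) * B' - R * B"
    unfolding norm[symmetric] by (simp add: R_def power2_eq_square algebra_simps)
  finally have "A * C = [:c:] * t ^ (2 * n) * B' - R * B" .
  moreover have "t ^ k dvd [:c:] * t ^ (2 * n) * B'"
    using \<open>t ^ k dvd t ^ (2 * n)\<close> by (intro dvd_mult2 dvd_mult)
  ultimately have "t ^ k dvd A * C"
    using tR by (simp add: dvd_diff)
  then have "t ^ k dvd C"
    using A unfolding t_def by (rule linear_power_dvd_cancel)
  \<comment> \<open>From \<open>deg g \<ge> 3\<close> one gets \<open>deg B \<le> n - 2\<close>, so
    \<open>C\<close> has degree at most \<open>2 n - 2\<close>. A quadratic \<open>g\<close> would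
    miss the bound by one.\<close>
  moreover have "Polynomial.degree C < k"
  proof -
    have "Polynomial.degree B' \<le> Polynomial.degree B"
      unfolding B'_def using deg by (intro degree_add_le) auto
    then have "Polynomial.degree (A * B') \<le> n + Polynomial.degree B"
      using dA degree_mult_le[of A B'] by linarith
    moreover have "Polynomial.degree (\<delta> A * B) \<le> n + Polynomial.degree B"
      using dA deg[of A] degree_mult_le[of "\<delta> A" B] by linarith
    ultimately have "Polynomial.degree C \<le> n + Polynomial.degree B"
      unfolding C_def by (intro degree_diff_le)
    then show ?thesis
      using dB g(2) k by linarith
  qed
  moreover have "Polynomial.degree (t ^ k) = k"
    by (simp add: t_def degree_linear_power)
  ultimately have "C = 0"
    using dvd_imp_degree_le by (metis not_le)
  \<comment> \<open>With \<open>C = 0\<close>, the product \<open>A R\<close> is the norm times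
    \<open>\<delta> A\<close>, so \<open>t\<close> divides \<open>R\<close> to the full order
    \<open>2 n\<close>. In the formula for \<open>2 R\<close> this leaves the term with
    \<open>t^k\<close>, which forces \<open>t\<close> to divide \<open>\<delta> t\<close>.\<close>
  have "A * R = A\<^sup>2 * \<delta> A - g * B * (A * B')"
    by (simp add: R_def power2_eq_square algebra_simps)
  also have "A * B' = \<delta> A * B"
    using \<open>C = 0\<close> by (simp add: C_def)
  also have "A\<^sup>2 * \<delta> A - g * B * (\<delta> A * B) = [:c:] * t ^ (2 * n) * \<delta> A"
    unfolding norm[symmetric] by (simp add: power2_eq_square algebra_simps)
  finally have "t ^ (2 * n) dvd A * R"
    by (metis dvd_mult2 dvd_triv_right)
  then have "t ^ (2 * n) dvd R"
    using A unfolding t_def by (rule linear_power_dvd_cancel)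
  then have "t ^ (2 * n) dvd 2 * R"
    by simp
  then have "t ^ (2 * n) dvd [:c:] * (of_nat (2 * n) * t ^ k * \<delta> t)"
    unfolding R by (simp add: dvd_add_right_iff)
  then have "t * t ^ k dvd Polynomial.smult (c * of_nat (2 * n)) (\<delta> t) * t ^ k"
    by (simp only: k power_Suc of_nat_poly) (simp add: algebra_simps)
  then have "t dvd Polynomial.smult (c * of_nat (2 * n)) (\<delta> t)"
    using \<open>t \<noteq> 0\<close> by (simp del: of_nat_mult mult_smult_left)
  then have "t dvd \<delta> t"
    using \<open>n > 0\<close> c(1) by (subst (asm) dvd_smult_iff) simp_all
  then show False
    using x0 by (simp add: t_def poly_eq_0_iff_dvd)
qed

text \<open>If \<open>A\<close> vanishes at \<open>x0\<close>, then so does \<open>B\<close>,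
  because \<open>g\<close> does not; cancelling \<open>x - x0\<close> from both lowers
  \<open>n\<close> by one. The degree bound excludes \<open>n = 0\<close>, so the process
  stops.\<close>

lemma pell_solution_reduce:
  fixes g :: "'a::field poly"
  assumes "pell_solution g x0 n A B" and "poly g x0 \<noteq> 0" and "Polynomial.degree g > 0"
  shows "\<exists>n' A' B'. pell_solution g x0 n' A' B' \<and> poly A' x0 \<noteq> 0"
  using assms(1)
proof (induction n arbitrary: A B)
  case 0
  then show ?case
    using assms(3) by (simp add: pell_solution_def)
next
  case (Suc n)
  show ?case
  proof (cases "poly A x0 = 0")
    case True
    define t where "t = [:- x0, 1:]"
    obtain c where c: "c \<noteq> 0" "A\<^sup>2 - g * B\<^sup>2 = Polynomial.smult c (t ^ (2 * Suc n))"
      using Suc.prems unfolding pell_solution_def t_def by auto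
    have "t \<noteq> 0" "Polynomial.degree t = 1"
      by (simp_all add: t_def)
    obtain A' where A': "A = t * A'"
      using True by (auto simp: poly_eq_0_iff_dvd t_def)
    have "t ^ 2 dvd A\<^sup>2 - Polynomial.smult c (t ^ (2 * Suc n))"
      unfolding A' power_mult_distrib by (intro dvd_diff dvd_triv_left dvd_smult le_imp_power_dvd) simp
    also have "A\<^sup>2 - Polynomial.smult c (t ^ (2 * Suc n)) = g * B\<^sup>2"
      using c(2) by (simp add: algebra_simps)
    finally have "t ^ 2 dvd B\<^sup>2"
      using assms(2) unfolding t_def by (rule linear_power_dvd_cancel)
    then have "t dvd B"
      by (metis dvd_trans dvd_triv_left poly_eq_0_iff_dvd poly_power power2_eq_square power_eq_0_iff t_def)
    then obtain B' where B': "B = t * B'"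
      by auto
    have "B \<noteq> 0"
      using Suc.prems by (simp add: pell_solution_def)
    then have "B' \<noteq> 0"
      by (auto simp: B')
    then have dB: "Polynomial.degree B = Suc (Polynomial.degree B')"
      using \<open>t \<noteq> 0\<close> \<open>Polynomial.degree t = 1\<close> by (simp add: B' degree_mult_eq)
    have dA: "Polynomial.degree A' \<le> n"
    proof (cases "A' = 0")
      case False
      then have "Polynomial.degree A = Suc (Polynomial.degree A')"
        using \<open>t \<noteq> 0\<close> \<open>Polynomial.degree t = 1\<close> by (simp add: A' degree_mult_eq)
      then show ?thesis
        using Suc.prems by (simp add: pell_solution_def)
    qed simp
    have "t\<^sup>2 * (A'\<^sup>2 - g * B'\<^sup>2) = t\<^sup>2 * Polynomial.smult c (t ^ (2 * n))"
      using c(2) by (simp add: A' B' power2_eq_square algebra_simps)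
    then have "A'\<^sup>2 - g * B'\<^sup>2 = Polynomial.smult c (t ^ (2 * n))"
      using \<open>t \<noteq> 0\<close> by (metis mult_cancel_left power_eq_0_iff)
    then have "pell_solution g x0 n A' B'"
      using \<open>B' \<noteq> 0\<close> dA dB c(1) Suc.prems unfolding pell_solution_def t_def by auto
    then show ?thesis
      by (rule Suc.IH)
  qed (use Suc.prems in blast)
qed

section \<open>Descent of Pell solutions to the ground field\<close>

text \<open>Newton iteration for the Taylor polynomial of \<open>y\<close> at the point
  \<open>(x0, y0)\<close>: each correction solves a linear equation with slope \<open>2 y0\<close>,
  which is nonzero.\<close>

lemma poly_sqrt_modulo_linear_power:
  fixes g :: "'a::field_char_0 poly"
  assumes "y0 \<noteq> 0" and "y0\<^sup>2 = poly g x0"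
  shows "\<exists>s. [:- x0, 1:] ^ k dvd s\<^sup>2 - g \<and> poly s x0 = y0"
proof (induction k)
  case 0
  show ?case
    by (intro exI[of _ "[:y0:]"]) simp
next
  case (Suc k)
  define t where "t = [:- x0, 1:]"
  obtain s where s: "t ^ k dvd s\<^sup>2 - g" "poly s x0 = y0"
    using Suc by (auto simp: t_def)
  show ?case
  proof (cases "k = 0")
    case True
    have "t dvd [:y0:]\<^sup>2 - g"
      using assms(2) by (simp add: t_def poly_eq_0_iff_dvd[symmetric])
    then show ?thesis
      using True by (intro exI[of _ "[:y0:]"]) (simp add: t_def)
  next
    case False
    obtain q where q: "s\<^sup>2 - g = t ^ k * q"
      using s(1) by auto
    \<comment> \<open>\<open>a\<close> makes \<open>q + 2 a s\<close> vanish at \<open>x0\<close>.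
      The quadratic term vanishes there only for \<open>k > 0\<close>, hence the separate first
      step.\<close>
    define a where "a = - poly q x0 / (2 * y0)"
    have "t dvd q + 2 * [:a:] * s + [:a:]\<^sup>2 * t ^ k"
      using False assms(1) s(2) by (simp add: t_def poly_eq_0_iff_dvd[symmetric] a_def)
    then have "t ^ k * t dvd t ^ k * (q + 2 * [:a:] * s + [:a:]\<^sup>2 * t ^ k)"
      by (rule mult_dvd_mono[OF dvd_refl])
    also have "t ^ k * (q + 2 * [:a:] * s + [:a:]\<^sup>2 * t ^ k) = (s\<^sup>2 - g) + 2 * [:a:] * s * t ^ k + [:a:]\<^sup>2 * (t ^ k)\<^sup>2"
      unfolding q by (simp only: algebra_simps power2_eq_square)
    also have "\<dots> = (s + [:a:] * t ^ k)\<^sup>2 - g"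
      by (simp only: algebra_simps power2_eq_square mult_2 mult_2_right)
    finally have "t ^ Suc k dvd (s + [:a:] * t ^ k)\<^sup>2 - g"
      by (simp only: power_Suc mult.commute)
    moreover have "poly (s + [:a:] * t ^ k) x0 = y0"
      using s(2) False by (simp add: t_def)
    ultimately show ?thesis
      unfolding t_def by blast
  qed
qed

text \<open>A single nonzero vector is independent, so a linear functional may be prescribed on it.
  Such functionals carry linear relations over the closure back to the ground field.\<close>

lemma alg_closure_functional:
  fixes z :: "'a::field alg_closure"
  assumes "z \<noteq> 0"
  shows "\<exists>\<phi>::'a alg_closure \<Rightarrow> 'a. (\<forall>a b. \<phi> (a + b) = \<phi> a + \<phi> b) \<and>
    (\<forall>c a. \<phi> (to_ac c * a) = c * \<phi> a) \<and> \<phi> z \<noteq> 0"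
proof -
  interpret vs: vector_space_pair "\<lambda>(c::'a) a. to_ac c * a" "(*) :: 'a \<Rightarrow> 'a \<Rightarrow> 'a"
    by unfold_locales (simp_all add: algebra_simps)
  have "vs.vs1.independent {z}"
    using assms by simp
  then obtain \<phi> where \<phi>: "Vector_Spaces.linear (\<lambda>c a. to_ac c * a) (*) \<phi>" "\<forall>x\<in>{z}. \<phi> x = (\<lambda>_. 1) x"
    using vs.linear_independent_extend by meson
  interpret Vector_Spaces.linear "\<lambda>c a. to_ac c * a" "(*)" \<phi>
    by (rule \<phi>(1))
  show ?thesis
    using \<phi>(2) by (intro exI[of _ \<phi>]) (simp add: add scale)
qed

lemma additive_sum:
  fixes \<phi> :: "'a::ab_group_add \<Rightarrow> 'b::ab_group_add"
  assumes "\<And>a b. \<phi> (a + b) = \<phi> a + \<phi> b"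
  shows "\<phi> (sum f S) = (\<Sum>i\<in>S. \<phi> (f i))"
proof -
  have "\<phi> 0 = 0"
    using assms[of 0 0] by simp
  then show ?thesis
    by (induction S rule: infinite_finite_induct) (simp_all add: assms)
qed

lemma map_poly_add_additive:
  fixes \<phi> :: "'a::ab_group_add \<Rightarrow> 'b::ab_group_add"
  assumes "\<And>a b. \<phi> (a + b) = \<phi> a + \<phi> b"
  shows "map_poly \<phi> (p + q) = map_poly \<phi> p + map_poly \<phi> q"
proof -
  have "\<phi> 0 = 0"
    using assms[of 0 0] by simp
  then show ?thesis
    by (intro poly_eqI) (simp add: coeff_map_poly assms)
qed

lemma map_poly_mult_semilinear:
  fixes \<phi> :: "'b::comm_ring_1 \<Rightarrow> 'a::comm_ring_1"
  assumes "\<And>a b. \<phi> (a + b) = \<phi> a + \<phi> b" and "\<And>c a. \<phi> (h c * a) = c * \<phi> a" and "h 0 = 0"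
  shows "map_poly \<phi> (map_poly h p * q) = p * map_poly \<phi> q"
proof -
  have "\<phi> 0 = 0"
    using assms(1)[of 0 0] by simp
  then show ?thesis
    by (intro poly_eqI) (simp add: coeff_map_poly assms coeff_mult additive_sum)
qed

lemma map_poly_mult_hom:
  fixes h :: "'a::comm_ring_1 \<Rightarrow> 'b::comm_ring_1"
  assumes "\<And>a b. h (a + b) = h a + h b" and "\<And>a b. h (a * b) = h a * h b"
  shows "map_poly h (p * q) = map_poly h p * map_poly h q"
proof -
  have "h 0 = 0"
    using assms(1)[of 0 0] by simp
  then show ?thesis
    by (intro poly_eqI) (simp add: coeff_map_poly assms coeff_mult additive_sum)
qed

lemma poly_map_poly_hom:
  fixes h :: "'a::comm_ring_1 \<Rightarrow> 'b::comm_ring_1"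
  assumes "\<And>a b. h (a + b) = h a + h b" and "\<And>a b. h (a * b) = h a * h b"
  shows "poly (map_poly h p) (h x) = h (poly p x)"
proof -
  have "h 0 = 0"
    using assms(1)[of 0 0] by simp
  then show ?thesis
    by (induction p) (simp_all add: map_poly_pCons assms)
qed

abbreviation ac_poly :: "'a::field poly \<Rightarrow> 'a alg_closure poly" where
  "ac_poly \<equiv> map_poly to_ac"

lemma ac_poly_simps [simp]:
  "ac_poly (p + q) = ac_poly p + ac_poly q"
  "ac_poly (p - q) = ac_poly p - ac_poly q"
  "ac_poly (- p) = - ac_poly p"
  "ac_poly (p * q) = ac_poly p * ac_poly q"
  "ac_poly 1 = 1"
  "ac_poly (Polynomial.smult c p) = Polynomial.smult (to_ac c) (ac_poly p)"
  "Polynomial.degree (ac_poly p) = Polynomial.degree p"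
  "poly (ac_poly p) (to_ac x) = to_ac (poly p x)"
  "ac_poly p = ac_poly q \<longleftrightarrow> p = q"
  by (simp_all add: map_poly_mult_hom poly_map_poly_hom degree_map_poly poly_eq_iff coeff_map_poly)

lemma ac_poly_power [simp]: "ac_poly (p ^ n) = ac_poly p ^ n"
  by (induction n) simp_all

text \<open>Modulo \<open>t^(2 n)\<close> the polynomial \<open>g\<close> is a square
  \<open>s^2\<close> over the ground field, and the Pell equation becomes the divisibility of
  \<open>A + s B\<close>. This is linear in \<open>A\<close> and \<open>B\<close>, so a functional
  can be applied to their coefficients without losing the degree bounds. The equation is recovered
  because the degrees leave only a constant cofactor.\<close>

lemma pell_descent:
  fixes g :: "'a::field_char_0 poly"
  assumes "y0 \<noteq> 0" and "y0\<^sup>2 = poly g x0" and "Polynomial.degree g > 0"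
    and nonsquare: "\<And>P Q. P\<^sup>2 = g * Q\<^sup>2 \<Longrightarrow> Q = 0"
    and "pell_solution (ac_poly g) (to_ac x0) n A B"
  shows "\<exists>n A B. pell_solution g x0 n A B"
proof -
  have "poly (ac_poly g) (to_ac x0) \<noteq> 0"
    using assms(1) by (simp add: assms(2)[symmetric])
  then obtain n A B where sol: "pell_solution (ac_poly g) (to_ac x0) n A B"
    and A: "poly A (to_ac x0) \<noteq> 0"
    using pell_solution_reduce[OF assms(5)] assms(3) by auto
  define t where "t = [:- x0, 1:]"
  have t: "ac_poly t = [:- to_ac x0, 1:]"
    by (simp add: t_def map_poly_pCons)
  obtain c where c: "A\<^sup>2 - ac_poly g * B\<^sup>2 = Polynomial.smult c (ac_poly t ^ (2 * n))"
    using sol by (auto simp: pell_solution_def t)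
  obtain s where s: "t ^ (2 * n) dvd s\<^sup>2 - g"
    using poly_sqrt_modulo_linear_power[OF assms(1,2)] unfolding t_def by blast
  \<comment> \<open>The factors \<open>A - s B\<close> and \<open>A + s B\<close> cannot both vanish
    at \<open>x0\<close>, as their sum is \<open>2 A\<close>. The whole power divides one of them,
    and the sign is absorbed into \<open>s\<close>.\<close>
  have "\<exists>s. t ^ (2 * n) dvd s\<^sup>2 - g \<and> ac_poly t ^ (2 * n) dvd A + ac_poly s * B"
  proof -
    have "ac_poly (t ^ (2 * n)) dvd ac_poly (s\<^sup>2 - g)"
      using s by (metis ac_poly_simps(4) dvd_def)
    then have "ac_poly t ^ (2 * n) dvd
        Polynomial.smult c (ac_poly t ^ (2 * n)) - B\<^sup>2 * ac_poly (s\<^sup>2 - g)"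
      by (intro dvd_diff dvd_smult dvd_mult) simp_all
    also have "\<dots> = (A - ac_poly s * B) * (A + ac_poly s * B)"
      unfolding c[symmetric] by (simp add: power2_eq_square algebra_simps)
    finally have dvd: "ac_poly t ^ (2 * n) dvd (A - ac_poly s * B) * (A + ac_poly s * B)" .
    show ?thesis
    proof (cases "poly (A - ac_poly s * B) (to_ac x0) = 0")
      case True
      then have "poly (A + ac_poly s * B) (to_ac x0) = 2 * poly A (to_ac x0)"
        by (simp add: algebra_simps)
      then have "poly (A + ac_poly s * B) (to_ac x0) \<noteq> 0"
        using A by simp
      then have "ac_poly t ^ (2 * n) dvd A - ac_poly s * B"
        using dvd linear_power_dvd_cancel[of "to_ac x0" "2 * n" "A + ac_poly s * B" "A - ac_poly s * B"]
        by (simp add: t mult.commute)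
      then show ?thesis
        using s by (intro exI[of _ "- s"]) simp
    next
      case False
      then have "ac_poly t ^ (2 * n) dvd A + ac_poly s * B"
        using dvd unfolding t by (metis linear_power_dvd_cancel)
      then show ?thesis
        using s by blast
    qed
  qed
  then obtain s Q where s: "t ^ (2 * n) dvd s\<^sup>2 - g"
    and Q: "A + ac_poly s * B = ac_poly (t ^ (2 * n)) * Q"
    by (auto simp: dvd_def)
  have "B \<noteq> 0"
    using sol by (simp add: pell_solution_def)
  \<comment> \<open>Nonvanishing at the leading coefficient of \<open>B\<close> keeps the descended
    \<open>B1\<close> nonzero.\<close>
  then obtain \<phi> :: "'a alg_closure \<Rightarrow> 'a" where add: "\<And>a b. \<phi> (a + b) = \<phi> a + \<phi> b"
    and scale: "\<And>c a. \<phi> (to_ac c * a) = c * \<phi> a" and \<phi>: "\<phi> (Polynomial.lead_coeff B) \<noteq> 0"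
    using alg_closure_functional[of "Polynomial.lead_coeff B"] by auto
  have "\<phi> 0 = 0"
    using add[of 0 0] by simp
  define A1 B1 where "A1 = map_poly \<phi> A" and "B1 = map_poly \<phi> B"
  have "B1 \<noteq> 0"
    using \<phi> \<open>\<phi> 0 = 0\<close> by (metis B1_def coeff_map_poly coeff_0)
  have "map_poly \<phi> (A + ac_poly s * B) = A1 + s * B1"
    by (simp add: A1_def B1_def map_poly_add_additive add map_poly_mult_semilinear scale)
  then have "A1 + s * B1 = t ^ (2 * n) * map_poly \<phi> Q"
    unfolding Q by (simp add: map_poly_mult_semilinear add scale del: ac_poly_power)
  then have "t ^ (2 * n) dvd A1 + s * B1"
    by simp
  then have "t ^ (2 * n) dvd (A1 - s * B1) * (A1 + s * B1) + B1\<^sup>2 * (s\<^sup>2 - g)"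
    using s by (rule dvd_add[OF dvd_mult dvd_mult])
  also have "(A1 - s * B1) * (A1 + s * B1) + B1\<^sup>2 * (s\<^sup>2 - g) = A1\<^sup>2 - g * B1\<^sup>2"
    by (simp add: power2_eq_square algebra_simps)
  finally obtain q where q: "A1\<^sup>2 - g * B1\<^sup>2 = t ^ (2 * n) * q"
    by (auto simp: dvd_def)
  have dA: "Polynomial.degree A1 \<le> n"
    using sol map_poly_degree_leq[of \<phi> A] by (simp add: A1_def pell_solution_def)
  have dB: "2 * Polynomial.degree B1 + Polynomial.degree g \<le> 2 * n"
    using sol map_poly_degree_leq[of \<phi> B] by (simp add: B1_def pell_solution_def)
  \<comment> \<open>The functional might have destroyed the norm; \<open>A1^2 = g B1^2\<close> is
    excluded by \<open>nonsquare\<close>.\<close>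
  have "q \<noteq> 0"
    using nonsquare[of A1 B1] \<open>B1 \<noteq> 0\<close> q by auto
  have "Polynomial.degree (A1\<^sup>2 - g * B1\<^sup>2) \<le> 2 * n"
  proof (rule degree_diff_le)
    show "Polynomial.degree (A1\<^sup>2) \<le> 2 * n"
      using dA degree_power_le[of A1 2] by linarith
    show "Polynomial.degree (g * B1\<^sup>2) \<le> 2 * n"
      using dB degree_power_le[of B1 2] degree_mult_le[of g "B1\<^sup>2"] by linarith
  qed
  moreover have "Polynomial.degree (t ^ (2 * n) * q) = 2 * n + Polynomial.degree q"
    using \<open>q \<noteq> 0\<close> by (subst degree_mult_eq) (simp_all add: t_def degree_linear_power)
  ultimately have "Polynomial.degree q = 0"
    using q by simp
  then obtain c1 where c1: "q = [:c1:]"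
    by (auto elim: degree_eq_zeroE)
  then have "A1\<^sup>2 - g * B1\<^sup>2 = Polynomial.smult c1 (t ^ (2 * n))" "c1 \<noteq> 0"
    using q \<open>q \<noteq> 0\<close> by (simp_all add: mult.commute)
  then show ?thesis
    using \<open>B1 \<noteq> 0\<close> dA dB unfolding pell_solution_def t_def by blast
qed

section \<open>Functions on a hyperelliptic curve\<close>

definition ff_poly :: "'k::field_char_0 alg_closure poly \<Rightarrow> 'k ff_closure" where
  "ff_poly p = to_ac (to_fract p)"

lemma ff_poly_simps [simp]:
  "ff_poly 0 = 0" "ff_poly 1 = 1"
  "ff_poly (p + q) = ff_poly p + ff_poly q"
  "ff_poly (p - q) = ff_poly p - ff_poly q"
  "ff_poly (- p) = - ff_poly p"
  "ff_poly (p * q) = ff_poly p * ff_poly q"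
  "ff_poly p = ff_poly q \<longleftrightarrow> p = q"
  "ff_poly p = 0 \<longleftrightarrow> p = 0"
  by (simp_all add: ff_poly_def)

lemma ff_poly_power [simp]: "ff_poly (p ^ n) = ff_poly p ^ n"
  by (induction n) simp_all

lemma ff_const_eq: "ff_const c = ff_poly [:c:]"
  by (simp add: ff_const_def ff_poly_def)

lemma ff_x_eq: "ff_x = ff_poly [:0, 1:]"
  by (simp add: ff_x_def ff_poly_def)

text \<open>A root of \<open>g\<close> is simple, so it would have even order in \<open>P^2\<close>
  and odd order in \<open>g Q^2\<close>.\<close>

lemma rsquarefree_not_square:
  fixes g :: "'a::alg_closed_field poly"
  assumes "rsquarefree g" and "Polynomial.degree g > 0" and "P\<^sup>2 = g * Q\<^sup>2"
  shows "Q = 0"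
proof (rule ccontr)
  assume "Q \<noteq> 0"
  obtain e where e: "poly g e = 0"
    using alg_closed_imp_poly_has_root assms(2) by blast
  have "g \<noteq> 0"
    using assms(1) by (simp add: rsquarefree_def)
  then have "Polynomial.order e g = 1"
    using rsquarefree_root_order[OF assms(1) e] by simp
  moreover have "P \<noteq> 0"
    using assms(3) \<open>Q \<noteq> 0\<close> \<open>g \<noteq> 0\<close> by auto
  have "Polynomial.order e (P\<^sup>2) = Polynomial.order e (g * Q\<^sup>2)"
    by (simp add: assms(3))
  ultimately show False
    using \<open>Q \<noteq> 0\<close> \<open>g \<noteq> 0\<close> \<open>P \<noteq> 0\<close> by (simp add: order_mult order_power_n_n power2_eq_square) presburger
qed

text \<open>All that is kept of \<open>\<Phi>\<close> is the square of its root \<open>y\<close>,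
  with \<open>g\<close> over the closed field of constants. Both kinds of twist fit after division
  by the coefficient of \<open>y^2\<close>.\<close>

locale hyperelliptic =
  fixes \<Phi> :: "'k::field_char_0 poly poly" and g :: "'k alg_closure poly"
  assumes y_square: "(ff_y \<Phi>)\<^sup>2 = ff_poly g"
    and squarefree: "rsquarefree g" and degree_g: "Polynomial.degree g \<ge> 3"
begin

text \<open>This is \<open>h = (A + B y) / C\<close> with the denominator cleared. Common factors
  are allowed, so the triple is unique only up to cross multiplication.\<close>

definition represents :: "'k ff_closure \<Rightarrow> 'k alg_closure poly \<Rightarrow> 'k alg_closure poly \<Rightarrow>
    'k alg_closure poly \<Rightarrow> bool" where
  "represents h A B C \<longleftrightarrow> C \<noteq> 0 \<and> h * ff_poly C = ff_poly A + ff_poly B * ff_y \<Phi>"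

lemma g_nonzero: "g \<noteq> 0"
  using degree_g by auto

lemma norm_eq_0D:
  assumes "A\<^sup>2 = g * B\<^sup>2"
  shows "A = 0 \<and> B = 0"
proof -
  have "B = 0"
    using rsquarefree_not_square[OF squarefree _ assms] degree_g by simp
  then show ?thesis
    using assms by simp
qed

lemma y_mult_y: "ff_y \<Phi> * ff_y \<Phi> = ff_poly g"
  using y_square by (simp add: power2_eq_square)

lemma ff_sum_eq_0D:
  assumes "ff_poly A + ff_poly B * ff_y \<Phi> = 0"
  shows "A = 0 \<and> B = 0"
proof (rule norm_eq_0D)
  have "ff_poly A = - (ff_poly B * ff_y \<Phi>)"
    using assms by (simp add: eq_neg_iff_add_eq_0)
  then have "(ff_poly A)\<^sup>2 = (ff_poly B * ff_y \<Phi>)\<^sup>2"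
    by simp
  then have "ff_poly (A\<^sup>2) = ff_poly (g * B\<^sup>2)"
    by (simp add: power_mult_distrib y_square mult.commute)
  then show "A\<^sup>2 = g * B\<^sup>2"
    by (simp only: ff_poly_simps(7))
qed

lemma represents_unique:
  assumes "represents h A B C" and "represents h A' B' C'"
  shows "A * C' = A' * C \<and> B * C' = B' * C"
proof -
  have "ff_poly (A * C' - A' * C) + ff_poly (B * C' - B' * C) * ff_y \<Phi>
      = (ff_poly A + ff_poly B * ff_y \<Phi>) * ff_poly C' - (ff_poly A' + ff_poly B' * ff_y \<Phi>) * ff_poly C"
    by (simp add: algebra_simps)
  also have "\<dots> = (h * ff_poly C) * ff_poly C' - (h * ff_poly C') * ff_poly C"
    using assms unfolding represents_def by simp
  also have "\<dots> = 0"
    by (simp only: mult.assoc mult.commute[of "ff_poly C"]) simp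
  finally have "A * C' - A' * C = 0 \<and> B * C' - B' * C = 0"
    by (rule ff_sum_eq_0D)
  then show ?thesis
    by simp
qed

lemma represents_add:
  assumes "represents h A B C" and "represents h' A' B' C'"
  shows "represents (h + h') (A * C' + A' * C) (B * C' + B' * C) (C * C')"
proof -
  have "(h + h') * ff_poly (C * C') = (h * ff_poly C) * ff_poly C' + (h' * ff_poly C') * ff_poly C"
    by (simp add: algebra_simps)
  also have "\<dots> = ff_poly (A * C' + A' * C) + ff_poly (B * C' + B' * C) * ff_y \<Phi>"
    using assms by (simp add: represents_def algebra_simps)
  finally show ?thesis
    using assms by (simp add: represents_def)
qed

lemma represents_mult:
  assumes "represents h A B C" and "represents h' A' B' C'"
  shows "represents (h * h') (A * A' + g * B * B') (A * B' + A' * B) (C * C')"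
proof -
  have "(h * h') * ff_poly (C * C') = (h * ff_poly C) * (h' * ff_poly C')"
    by (simp add: algebra_simps)
  also have "\<dots> = (ff_poly A + ff_poly B * ff_y \<Phi>) * (ff_poly A' + ff_poly B' * ff_y \<Phi>)"
    using assms by (simp add: represents_def)
  also have "\<dots> = ff_poly (A * A') + ff_poly B * ff_poly B' * (ff_y \<Phi> * ff_y \<Phi>) + ff_poly (A * B' + A' * B) * ff_y \<Phi>"
    by (simp add: algebra_simps)
  also have "\<dots> = ff_poly (A * A' + g * B * B') + ff_poly (A * B' + A' * B) * ff_y \<Phi>"
    by (simp add: y_mult_y algebra_simps)
  finally show ?thesis
    using assms by (simp add: represents_def)
qed

lemma represents_poly: "represents (ff_poly p) p 0 1"
  by (simp add: represents_def)

lemma represents_y: "represents (ff_y \<Phi>) 0 1 1"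
  by (simp add: represents_def)

text \<open>Multiplication by the conjugate \<open>A - B y\<close> makes the denominator the norm,
  which is nonzero because \<open>y\<close> is not a rational function of \<open>x\<close>.\<close>

lemma represents_inverse:
  assumes "represents h A B C" and "h \<noteq> 0"
  shows "represents (inverse h) (A * C) (- B * C) (A\<^sup>2 - g * B\<^sup>2)"
proof -
  have C: "C \<noteq> 0" and h: "h * ff_poly C = ff_poly A + ff_poly B * ff_y \<Phi>"
    using assms by (auto simp: represents_def)
  have "A\<^sup>2 - g * B\<^sup>2 \<noteq> 0"
  proof
    assume "A\<^sup>2 - g * B\<^sup>2 = 0"
    then have "A = 0 \<and> B = 0"
      by (intro norm_eq_0D) simp
    then show False
      using C h assms(2) by simp
  qed
  moreover have "h * (ff_poly (A * C) + ff_poly (- B * C) * ff_y \<Phi>) = (h * ff_poly C) * (ff_poly A - ff_poly B * ff_y \<Phi>)"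
    by (simp add: algebra_simps)
  then have "h * (ff_poly (A * C) + ff_poly (- B * C) * ff_y \<Phi>)
      = ff_poly A * ff_poly A - ff_poly B * ff_poly B * (ff_y \<Phi> * ff_y \<Phi>)"
    unfolding h by (simp add: algebra_simps)
  then have "h * (ff_poly (A * C) + ff_poly (- B * C) * ff_y \<Phi>) = ff_poly (A\<^sup>2 - g * B\<^sup>2)"
    by (simp add: y_mult_y power2_eq_square mult.commute mult.left_commute)
  then have "inverse h * ff_poly (A\<^sup>2 - g * B\<^sup>2) = ff_poly (A * C) + ff_poly (- B * C) * ff_y \<Phi>"
    using assms(2) by (metis (no_types, lifting) left_inverse mult.assoc mult_1)
  ultimately show ?thesis
    by (simp add: represents_def)
qed

text \<open>The relation \<open>y^2 = g\<close> reduces every polynomial in \<open>y\<close> to one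
  of degree at most one.\<close>

lemma fun_field_iff: "h \<in> fun_field \<Phi> \<longleftrightarrow> (\<exists>A B C. represents h A B C)"
proof
  assume "h \<in> fun_field \<Phi>"
  then obtain q where q: "h = poly (map_poly to_ac q) (ff_y \<Phi>)"
    by (auto simp: fun_field_def)
  have "\<exists>A B C. represents (poly (map_poly to_ac q) (ff_y \<Phi>)) A B C"
  proof (induction q)
    case 0
    show ?case
      using represents_poly[of 0] by auto
  next
    case (pCons a q)
    obtain num den where "a = Fract num den" "den \<noteq> 0"
      by (cases a)
    then have "represents (to_ac a) num 0 den"
      by (simp add: represents_def Fract_conv_to_fract ff_poly_def)
    moreover obtain A B C where "represents (poly (map_poly to_ac q) (ff_y \<Phi>)) A B C"
      using pCons.IH by blast
    ultimately show ?case
      using represents_add represents_mult represents_y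
      by (simp add: map_poly_pCons) blast
  qed
  then show "\<exists>A B C. represents h A B C"
    by (simp add: q)
next
  assume "\<exists>A B C. represents h A B C"
  then obtain A B C where "C \<noteq> 0" "h * ff_poly C = ff_poly A + ff_poly B * ff_y \<Phi>"
    by (auto simp: represents_def)
  then have "h = poly (map_poly to_ac [:to_fract A / to_fract C, to_fract B / to_fract C:]) (ff_y \<Phi>)"
    by (simp add: map_poly_pCons ff_poly_def field_simps)
  then show "h \<in> fun_field \<Phi>"
    unfolding fun_field_def by blast
qed

lemma fun_field_poly [simp]: "ff_poly p \<in> fun_field \<Phi>"
  using represents_poly fun_field_iff by blast

lemma fun_field_0 [simp]: "0 \<in> fun_field \<Phi>"
  using fun_field_poly[of 0] by simp

lemma fun_field_1 [simp]: "1 \<in> fun_field \<Phi>"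
  using fun_field_poly[of 1] by simp

lemma fun_field_y [simp]: "ff_y \<Phi> \<in> fun_field \<Phi>"
  using represents_y fun_field_iff by blast

lemma fun_field_add [simp]: "h \<in> fun_field \<Phi> \<Longrightarrow> h' \<in> fun_field \<Phi> \<Longrightarrow> h + h' \<in> fun_field \<Phi>"
  unfolding fun_field_iff using represents_add by blast

lemma fun_field_mult [simp]: "h \<in> fun_field \<Phi> \<Longrightarrow> h' \<in> fun_field \<Phi> \<Longrightarrow> h * h' \<in> fun_field \<Phi>"
  unfolding fun_field_iff using represents_mult by blast

lemma fun_field_inverse [simp]: "h \<in> fun_field \<Phi> \<Longrightarrow> inverse h \<in> fun_field \<Phi>"
  using represents_inverse fun_field_iff by (cases "h = 0") (auto, blast)

end

section \<open>Places from Laurent expansions\<close>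

text \<open>Substitution of the Laurent series \<open>\<xi>\<close> for \<open>x\<close>; with a
  series \<open>\<eta>\<close> for \<open>y\<close> it parametrises a branch of the curve.\<close>

definition fls_eval :: "'a::field fls \<Rightarrow> 'a poly \<Rightarrow> 'a fls" where
  "fls_eval \<xi> p = poly (map_poly fls_const p) \<xi>"

lemma fls_eval_simps [simp]:
  "fls_eval \<xi> 0 = 0" "fls_eval \<xi> 1 = 1"
  "fls_eval \<xi> [:c:] = fls_const c"
  "fls_eval \<xi> (pCons c p) = fls_const c + \<xi> * fls_eval \<xi> p"
  "fls_eval \<xi> (p + q) = fls_eval \<xi> p + fls_eval \<xi> q"
  "fls_eval \<xi> (p * q) = fls_eval \<xi> p * fls_eval \<xi> q"
  by (simp_all add: fls_eval_def map_poly_pCons map_poly_1 map_poly_mult_hom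
      map_poly_add_additive fls_plus_const[symmetric])

lemma fls_eval_minus [simp]: "fls_eval \<xi> (- p) = - fls_eval \<xi> p"
  using fls_eval_simps(5)[of \<xi> p "- p"] by (simp add: eq_neg_iff_add_eq_0 add.commute)

lemma fls_eval_diff [simp]: "fls_eval \<xi> (p - q) = fls_eval \<xi> p - fls_eval \<xi> q"
  using fls_eval_simps(5)[of \<xi> p "- q"] by simp

lemma fls_eval_power [simp]: "fls_eval \<xi> (p ^ n) = fls_eval \<xi> p ^ n"
  by (induction n) simp_all

text \<open>Over a closed field \<open>p\<close> splits into linear factors, and
  \<open>\<xi> - e\<close> is nonzero because \<open>\<xi>\<close> is not constant.\<close>

lemma fls_eval_nonzero:
  fixes p :: "'a::alg_closed_field poly"
  assumes "\<xi> \<notin> range fls_const" and "p \<noteq> 0"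
  shows "fls_eval \<xi> p \<noteq> 0"
  using assms(2)
proof (induction "Polynomial.degree p" arbitrary: p)
  case 0
  then obtain c where "p = [:c:]"
    by (metis degree_eq_zeroE)
  then show ?case
    using 0 by simp
next
  case (Suc d)
  then obtain e where "poly p e = 0"
    using alg_closed_imp_poly_has_root[of p] by auto
  then obtain q where q: "p = [:- e, 1:] * q"
    by (auto simp: poly_eq_0_iff_dvd)
  then have "q \<noteq> 0"
    using Suc.prems by auto
  then have "Polynomial.degree p = Suc (Polynomial.degree q)"
    unfolding q by (subst degree_mult_eq) simp_all
  then have "fls_eval \<xi> q \<noteq> 0"
    using Suc \<open>q \<noteq> 0\<close> by simp
  moreover have "fls_eval \<xi> [:- e, 1:] = \<xi> - fls_const e"
    by simp
  ultimately show ?case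
    using assms(1) unfolding q fls_eval_simps(6) by auto
qed

text \<open>The least positive element generates. This serves to normalise a valuation whose value
  group may be a proper subgroup of the integers.\<close>

lemma int_subgroup_generator:
  fixes T :: "int set"
  assumes diff: "\<And>a b. a \<in> T \<Longrightarrow> b \<in> T \<Longrightarrow> a - b \<in> T" and "a \<in> T" "a \<noteq> 0"
  shows "\<exists>r\<in>T. r > 0 \<and> (\<forall>b\<in>T. r dvd b)"
proof -
  have "0 \<in> T"
    using diff[OF assms(2,2)] by simp
  then have uminus: "- b \<in> T" if "b \<in> T" for b
    using diff[of 0 b] that by simp
  have add: "b + c \<in> T" if "b \<in> T" "c \<in> T" for b c
    using diff[OF that(1) uminus[OF that(2)]] by simp
  have nat_mult: "int n * b \<in> T" if "b \<in> T" for n b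
    by (induction n) (use that \<open>0 \<in> T\<close> add in \<open>auto simp: algebra_simps\<close>)
  have mult: "k * b \<in> T" if "b \<in> T" for k b
    using nat_mult[OF that, of "nat \<bar>k\<bar>"] uminus by (cases "k \<ge> 0") force+
  have "\<bar>a\<bar> \<in> T"
    using uminus assms(2) by (simp add: abs_if)
  then have ex: "\<exists>n::nat. n > 0 \<and> int n \<in> T"
    using assms(3) by (intro exI[of _ "nat \<bar>a\<bar>"]) simp
  define n where "n = (LEAST n. n > 0 \<and> int n \<in> T)"
  have n: "n > 0" "int n \<in> T"
    using LeastI_ex[OF ex] by (auto simp: n_def)
  have "int n dvd b" if "b \<in> T" for b
  proof (rule ccontr)
    assume "\<not> int n dvd b"
    then have "b mod int n > 0"
      using n(1) by (metis dvd_eq_mod_eq_0 less_le of_nat_0_less_iff pos_mod_sign)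
    moreover have "b mod int n \<in> T"
      using diff[OF that mult[OF n(2), of "b div int n"]] by (simp add: minus_div_mult_eq_mod)
    ultimately have "n \<le> nat (b mod int n)"
      unfolding n_def by (intro Least_le) simp
    then show False
      using n(1) \<open>b mod int n > 0\<close> pos_mod_bound[of "int n" b] by linarith
  qed
  then show ?thesis
    using n by force
qed

context hyperelliptic
begin

text \<open>The product with the conjugate expansion is the expansion of the norm, a nonzero
  polynomial in \<open>x\<close>.\<close>

lemma represents_unit:
  assumes "represents h A B C" and "h \<noteq> 0" and "\<eta>\<^sup>2 = fls_eval \<xi> g" and "\<xi> \<notin> range fls_const"
  shows "fls_eval \<xi> A + fls_eval \<xi> B * \<eta> \<noteq> 0"
proof -
  have "represents (inverse h) (A * C) (- B * C) (A\<^sup>2 - g * B\<^sup>2)"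
    using assms by (intro represents_inverse)
  then have "A\<^sup>2 - g * B\<^sup>2 \<noteq> 0"
    by (simp add: represents_def)
  then have "fls_eval \<xi> (A\<^sup>2 - g * B\<^sup>2) \<noteq> 0"
    using assms(4) fls_eval_nonzero by blast
  moreover have "fls_eval \<xi> (A\<^sup>2 - g * B\<^sup>2) =
      (fls_eval \<xi> A + fls_eval \<xi> B * \<eta>) * (fls_eval \<xi> A - fls_eval \<xi> B * \<eta>)"
    by (simp add: assms(3)[symmetric] power2_eq_square algebra_simps)
  ultimately show ?thesis
    by auto
qed

text \<open>The substitution embeds the function field into the Laurent series. The order there is a
  valuation, which is divided by the generator \<open>r\<close> of its value group; \<open>p\<close>
  ensures that this group is not zero.\<close>

lemma place_exists:
  fixes \<xi> \<eta> :: "'k alg_closure fls"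
  assumes \<eta>: "\<eta>\<^sup>2 = fls_eval \<xi> g" and \<xi>: "\<xi> \<notin> range fls_const"
    and p: "p \<noteq> 0" "fls_subdegree (fls_eval \<xi> p) \<noteq> 0"
  shows "\<exists>v\<in>curve_points \<Phi>. \<exists>r>0. \<forall>h A B C. h \<noteq> 0 \<longrightarrow> represents h A B C \<longrightarrow>
    r * v h = fls_subdegree (fls_eval \<xi> A + fls_eval \<xi> B * \<eta>) - fls_subdegree (fls_eval \<xi> C)"
proof -
  \<comment> \<open>The image of \<open>h\<close> is read off from an arbitrary representation;
    \<open>represents_unique\<close> makes it independent of the choice.\<close>
  define \<theta> where "\<theta> h = (SOME z. \<exists>A B C. represents h A B C \<and>
    z = (fls_eval \<xi> A + fls_eval \<xi> B * \<eta>) / fls_eval \<xi> C)" for h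
  have \<theta>: "\<theta> h = (fls_eval \<xi> A + fls_eval \<xi> B * \<eta>) / fls_eval \<xi> C" if rep: "represents h A B C" for h A B C
  proof -
    have "\<exists>z. \<exists>A B C. represents h A B C \<and> z = (fls_eval \<xi> A + fls_eval \<xi> B * \<eta>) / fls_eval \<xi> C"
      using rep by blast
    then obtain A' B' C' where rep': "represents h A' B' C'"
      and eq: "\<theta> h = (fls_eval \<xi> A' + fls_eval \<xi> B' * \<eta>) / fls_eval \<xi> C'"
      using someI_ex[of "\<lambda>z. \<exists>A B C. represents h A B C \<and> z = (fls_eval \<xi> A + fls_eval \<xi> B * \<eta>) / fls_eval \<xi> C"]
      unfolding \<theta>_def by blast
    have "fls_eval \<xi> (A * C') = fls_eval \<xi> (A' * C)" "fls_eval \<xi> (B * C') = fls_eval \<xi> (B' * C)"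
      using represents_unique[OF rep rep'] by simp_all
    then have "fls_eval \<xi> (A' * C) + fls_eval \<xi> (B' * C) * \<eta> = fls_eval \<xi> (A * C') + fls_eval \<xi> (B * C') * \<eta>"
      by simp
    then have "(fls_eval \<xi> A' + fls_eval \<xi> B' * \<eta>) * fls_eval \<xi> C = (fls_eval \<xi> A + fls_eval \<xi> B * \<eta>) * fls_eval \<xi> C'"
      by (simp add: algebra_simps)
    moreover have "fls_eval \<xi> C \<noteq> 0" "fls_eval \<xi> C' \<noteq> 0"
      using rep rep' fls_eval_nonzero[OF \<xi>] by (auto simp: represents_def)
    ultimately show ?thesis
      unfolding eq by (simp add: frac_eq_eq)
  qed
  have C_nonzero: "fls_eval \<xi> C \<noteq> 0" if "represents h A B C" for h A B C
    using that fls_eval_nonzero[OF \<xi>] by (auto simp: represents_def)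
  have add: "\<theta> (h + h') = \<theta> h + \<theta> h'" if mem: "h \<in> fun_field \<Phi>" "h' \<in> fun_field \<Phi>" for h h'
  proof -
    obtain A B C A' B' C' where rep: "represents h A B C" "represents h' A' B' C'"
      using mem fun_field_iff by meson
    show ?thesis
      using C_nonzero[OF rep(1)] C_nonzero[OF rep(2)]
      by (simp add: \<theta>[OF rep(1)] \<theta>[OF rep(2)] \<theta>[OF represents_add[OF rep]] add_frac_eq) (simp add: algebra_simps)
  qed
  have mult: "\<theta> (h * h') = \<theta> h * \<theta> h'" if mem: "h \<in> fun_field \<Phi>" "h' \<in> fun_field \<Phi>" for h h'
  proof -
    obtain A B C A' B' C' where rep: "represents h A B C" "represents h' A' B' C'"
      using mem fun_field_iff by meson
    show ?thesis
      by (simp add: \<theta>[OF rep(1)] \<theta>[OF rep(2)] \<theta>[OF represents_mult[OF rep]])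
        (simp add: algebra_simps \<eta>[symmetric] power2_eq_square)
  qed
  have nonzero: "\<theta> h \<noteq> 0" if mem: "h \<in> fun_field \<Phi>" "h \<noteq> 0" for h
  proof -
    obtain A B C where rep: "represents h A B C"
      using mem(1) fun_field_iff by meson
    show ?thesis
      using represents_unit[OF rep mem(2) \<eta> \<xi>] C_nonzero[OF rep] by (simp add: \<theta>[OF rep])
  qed
  let ?F = "fun_field \<Phi> - {0}"
  define T where "T = (\<lambda>h. fls_subdegree (\<theta> h)) ` ?F"
  have sub_mult: "fls_subdegree (\<theta> (h * h')) = fls_subdegree (\<theta> h) + fls_subdegree (\<theta> h')"
    if "h \<in> ?F" "h' \<in> ?F" for h h'
    using that by (simp add: mult nonzero)
  have \<theta>_poly: "\<theta> (ff_poly q) = fls_eval \<xi> q" for q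
    using \<theta>[OF represents_poly] by simp
  have "a - b \<in> T" if ab: "a \<in> T" "b \<in> T" for a b
  proof -
    obtain h h' where h: "h \<in> ?F" "h' \<in> ?F" "a = fls_subdegree (\<theta> h)" "b = fls_subdegree (\<theta> h')"
      using ab by (auto simp: T_def)
    then have inv: "inverse h' \<in> ?F"
      by simp
    have "fls_subdegree (\<theta> (inverse h')) + fls_subdegree (\<theta> h') = fls_subdegree (\<theta> (inverse h' * h'))"
      using sub_mult[OF inv h(2)] by simp
    also have "inverse h' * h' = ff_poly 1"
      using h(2) by simp
    finally have "fls_subdegree (\<theta> (h * inverse h')) = a - b"
      using sub_mult[OF h(1) inv] h by (simp add: \<theta>_poly del: ff_poly_simps)
    moreover have "h * inverse h' \<in> ?F"
      using h inv by simp
    ultimately show ?thesis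
      unfolding T_def by (metis image_eqI)
  qed
  note diff = this
  have pT: "fls_subdegree (fls_eval \<xi> p) \<in> T"
    unfolding T_def using p(1) by (intro image_eqI[of _ _ "ff_poly p"]) (simp_all add: \<theta>_poly)
  obtain r where r: "r \<in> T" "r > 0" "\<And>a. a \<in> T \<Longrightarrow> r dvd a"
    using int_subgroup_generator[OF diff pT p(2)] by auto
  define v where "v h = (if h \<in> ?F then fls_subdegree (\<theta> h) div r else 0)" for h
  have v: "r * v h = fls_subdegree (\<theta> h)" if "h \<in> ?F" for h
    using that r(2) r(3)[of "fls_subdegree (\<theta> h)"] by (auto simp: v_def T_def)
  have "v \<in> curve_points \<Phi>"
    unfolding curve_points_def mem_Collect_eq
  proof (intro conjI allI ballI impI)
    fix h assume "h \<notin> ?F"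
    then show "v h = 0"
      by (auto simp: v_def)
  next
    fix h h' assume h: "h \<in> ?F" "h' \<in> ?F"
    have "r * v (h * h') = r * (v h + v h')"
      using h sub_mult[OF h] by (simp add: v distrib_left)
    then show "v (h * h') = v h + v h'"
      using r(2) by simp
  next
    fix h h' assume h: "h \<in> ?F" "h' \<in> ?F" "h + h' \<noteq> 0"
    then have "\<theta> h + \<theta> h' \<noteq> 0"
      using nonzero[of "h + h'"] by (simp add: add)
    then have "min (fls_subdegree (\<theta> h)) (fls_subdegree (\<theta> h')) \<le> fls_subdegree (\<theta> (h + h'))"
      using h by (simp add: add fls_plus_subdegree)
    then have "min (r * v h) (r * v h') \<le> r * v (h + h')"
      using h by (simp add: v)
    then have "r * min (v h) (v h') \<le> r * v (h + h')"
      using r(2) by (simp add: min_def split: if_splits)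
    then show "min (v h) (v h') \<le> v (h + h')"
      using r(2) by simp
  next
    fix c
    show "v (ff_const c) = 0"
      by (simp add: v_def ff_const_eq \<theta>_poly)
  next
    obtain h where "h \<in> ?F" "r = fls_subdegree (\<theta> h)"
      using r(1) by (auto simp: T_def)
    then have "r * v h = r * 1" "h \<in> fun_field \<Phi>"
      using v by simp_all
    then show "\<exists>h\<in>fun_field \<Phi>. v h = 1"
      using r(2) by (metis less_irrefl mult_left_cancel)
  qed
  moreover have "r * v h = fls_subdegree (fls_eval \<xi> A + fls_eval \<xi> B * \<eta>) - fls_subdegree (fls_eval \<xi> C)"
    if "h \<noteq> 0" and rep: "represents h A B C" for h A B C
  proof -
    have "h \<in> ?F"
      using that fun_field_iff by auto
    then show ?thesis
      using represents_unit[OF rep that(1) \<eta> \<xi>] C_nonzero[OF rep]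
      by (simp add: v \<theta>[OF rep] fls_divide_subdegree)
  qed
  ultimately show ?thesis
    using r(2) by blast
qed

end

lemma curve_points_mult:
  assumes "v \<in> curve_points \<Phi>" "g \<in> fun_field \<Phi>" "h \<in> fun_field \<Phi>" "g \<noteq> 0" "h \<noteq> 0"
  shows "v (g * h) = v g + v h"
  using assms by (simp add: curve_points_def)

lemma curve_points_add:
  assumes "v \<in> curve_points \<Phi>" "g \<in> fun_field \<Phi>" "h \<in> fun_field \<Phi>" "g \<noteq> 0" "h \<noteq> 0" "g + h \<noteq> 0"
  shows "v (g + h) \<ge> min (v g) (v h)"
  using assms by (simp add: curve_points_def)

lemma curve_points_const:
  assumes "v \<in> curve_points \<Phi>"
  shows "v (ff_const c) = 0"
  using assms by (simp add: curve_points_def)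

section \<open>Expansions at finite points and at infinity\<close>

text \<open>An even power of the variable splits off as a square, and the remaining unit power
  series has a square root because its constant term has one.\<close>

lemma fls_sqrt_exists:
  fixes f :: "'a::{alg_closed_field, field_char_0} fls"
  assumes "even (fls_subdegree f)"
  shows "\<exists>\<eta>. \<eta>\<^sup>2 = f"
proof (cases "f = 0")
  case False
  define u where "u = fls_base_factor_to_fps f"
  obtain k where k: "fls_subdegree f = k + k"
    using assms by (metis evenE mult_2)
  have u0: "fps_nth u 0 \<noteq> 0"
    using False by (simp add: u_def fls_base_factor_to_fps_nth)
  obtain a where a: "a\<^sup>2 = fps_nth u 0"
    using nth_root_exists[of 2 "fps_nth u 0"] by auto
  define s where "s = fps_radical (\<lambda>_ _. a) (Suc 1) u"
  have "s ^ Suc 1 = u"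
    unfolding s_def using power_radical[OF u0, of "\<lambda>_ _. a" 1] a by (simp add: power2_eq_square)
  then have "(fls_shift (- k) (fps_to_fls s))\<^sup>2 = fls_shift (- (k + k)) (fps_to_fls u)"
    by (simp add: power2_eq_square fls_shifted_times_simps fls_times_fps_to_fls[symmetric])
  also have "\<dots> = f"
    unfolding k[symmetric] u_def by (rule fls_conv_base_factor_to_fps_shift_subdegree[symmetric])
  finally show ?thesis
    by blast
qed (auto intro: exI[of _ 0])

text \<open>
  The substitution \<open>x = e + t\<^sup>2\<close> gives \<open>g\<close> an even order, so that \<open>y\<close> has a Laurent expansion in \<open>t\<close>
  whether or not \<open>e\<close> is a branch point. The order in \<open>t\<close> is a multiple of the normalised valuation.
\<close>

definition fls_at :: "'a::field \<Rightarrow> 'a fls" where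
  "fls_at e = fls_const e + fls_X\<^sup>2"

lemma fls_at_not_const: "fls_at e \<notin> range fls_const"
proof
  assume "fls_at e \<in> range fls_const"
  then obtain c where c: "fls_at e = fls_const c"
    by auto
  then have "fls_nth (fls_at e) 2 = 0"
    by simp
  then show False
    by (simp add: fls_at_def)
qed

lemma fls_eval_at_linear: "fls_eval (fls_at e) [:- e, 1:] = fls_X\<^sup>2"
  by (simp add: fls_at_def)

lemma fls_eval_at:
  "\<exists>u. fls_eval (fls_at e) p = fls_const (poly p e) + fls_X\<^sup>2 * fps_to_fls u"
proof -
  have "\<exists>u. fls_eval (fls_at e) q = fps_to_fls u" for q
  proof (induction q)
    case 0
    show ?case
      by (intro exI[of _ 0]) simp
  next
    case (pCons a q)
    then obtain u where "fls_eval (fls_at e) q = fps_to_fls u"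
      by blast
    then have "fls_eval (fls_at e) (pCons a q) = fps_to_fls (fps_const a + (fps_const e + fps_X\<^sup>2) * u)"
      by (simp add: fls_at_def fls_times_fps_to_fls fps_to_fls_power)
    then show ?case
      by blast
  qed
  then obtain u where u: "fls_eval (fls_at e) (synthetic_div p e) = fps_to_fls u"
    by blast
  have "p = [:- e, 1:] * synthetic_div p e + [:poly p e:]"
    by (rule synthetic_div_correct'[symmetric])
  then have "fls_eval (fls_at e) p = fls_eval (fls_at e) ([:- e, 1:] * synthetic_div p e + [:poly p e:])"
    by simp
  then show ?thesis
    by (metis u fls_eval_at_linear fls_eval_simps(3,5,6) add.commute)
qed

lemma fls_nth_eval_at_0: "fls_nth (fls_eval (fls_at e) p) 0 = poly p e"
proof -
  obtain u where "fls_eval (fls_at e) p = fls_const (poly p e) + fls_X\<^sup>2 * fps_to_fls u"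
    using fls_eval_at by blast
  then show ?thesis
    by (simp add: fls_X_power_times_conv_shift)
qed

lemma fls_subdegree_eval_at_unit:
  assumes "poly p e \<noteq> 0"
  shows "fls_subdegree (fls_eval (fls_at e) p) = 0"
proof -
  obtain u where "fls_eval (fls_at e) p = fls_const (poly p e) + fls_X\<^sup>2 * fps_to_fls u"
    using fls_eval_at by blast
  then show ?thesis
    using assms by (intro fls_subdegree_eqI) (simp_all add: fls_X_power_times_conv_shift)
qed

lemma fls_subdegree_eval_at:
  fixes p :: "'a::field poly"
  assumes "p \<noteq> 0"
  shows "fls_subdegree (fls_eval (fls_at e) p) = 2 * int (Polynomial.order e p)"
proof -
  obtain q where q: "p = [:- e, 1:] ^ Polynomial.order e p * q" "\<not> [:- e, 1:] dvd q"
    using order_decomp[OF assms] by blast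
  then have "poly q e \<noteq> 0"
    by (simp add: poly_eq_0_iff_dvd)
  then have q0: "fls_subdegree (fls_eval (fls_at e) q) = 0" "fls_eval (fls_at e) q \<noteq> 0"
    using fls_subdegree_eval_at_unit[of q e] fls_nth_eval_at_0[of e q] by force+
  have "fls_eval (fls_at e) p = (fls_X\<^sup>2) ^ Polynomial.order e p * fls_eval (fls_at e) q"
    by (subst q(1)) (simp only: fls_eval_simps(6) fls_eval_power fls_eval_at_linear)
  also have "\<dots> = fls_X ^ (2 * Polynomial.order e p) * fls_eval (fls_at e) q"
    by (simp only: power_mult)
  finally show ?thesis
    using q0 by simp
qed

text \<open>The substitution \<open>x = t^(-2)\<close>. The square makes the order of
  \<open>g\<close> even for odd degree too, so \<open>y\<close> has an expansion whether there are
  one or two points at infinity.\<close>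

definition fls_infinity :: "'a::field fls" where
  "fls_infinity = fls_X_inv\<^sup>2"

lemma fls_infinity_not_const: "(fls_infinity :: 'a::field fls) \<notin> range fls_const"
proof
  assume "(fls_infinity :: 'a fls) \<in> range fls_const"
  then obtain c :: 'a where "fls_X_inv\<^sup>2 = fls_const c"
    by (auto simp: fls_infinity_def)
  then have "fls_subdegree (fls_X_inv\<^sup>2 :: 'a fls) = 0"
    by (metis fls_const_subdegree)
  then show False
    by (simp only: fls_subdegree_fls_X_inv_pow)
qed

lemma fls_subdegree_eval_infinity:
  fixes p :: "'a::field poly"
  assumes "p \<noteq> 0"
  shows "fls_subdegree (fls_eval fls_infinity p) = - 2 * int (Polynomial.degree p) \<and> fls_eval fls_infinity p \<noteq> 0"
  using assms
proof (induction p)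
  case (pCons a p)
  show ?case
  proof (cases "p = 0")
    case True
    then show ?thesis
      using pCons.hyps by simp
  next
    case False
    define f where "f = fls_infinity * fls_eval fls_infinity p"
    have f: "f \<noteq> 0" "fls_subdegree f = - 2 * int (Polynomial.degree (pCons a p))"
      using pCons.IH[OF False] False by (simp_all add: f_def fls_infinity_def)
    then have "fls_subdegree f < 0"
      using False by simp
    then have "fls_subdegree (fls_const a + f) = fls_subdegree f"
      using f(1) by (intro fls_subdegree_add_eq2) simp_all
    moreover have "fls_const a + f \<noteq> 0"
      using \<open>fls_subdegree f < 0\<close> calculation by auto
    ultimately show ?thesis
      using f by (simp add: f_def)
  qed
qed simp

text \<open>Applied to conjugate expressions, this bounds the order of one of their two parts. The
  condition \<open>u \<noteq> 0\<close> matters since the zero series has subdegree \<open>0\<close>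
  by convention.\<close>

lemma two_times_fls_subdegree_ge:
  fixes f h :: "'a::field_char_0 fls"
  assumes "f + h = 2 * u" and "u \<noteq> 0" and "N \<le> fls_subdegree f" and "N \<le> fls_subdegree h"
  shows "N \<le> fls_subdegree u"
proof -
  have "f + h \<noteq> 0"
    using assms(1,2) by simp
  then have "N \<le> fls_subdegree (f + h)"
    using fls_plus_subdegree[of f h] assms(3,4) by linarith
  then show ?thesis
    using assms(1,2) by simp
qed

section \<open>From a principal divisor to a Pell solution\<close>

context hyperelliptic
begin

lemma curve_points_power:
  assumes "v \<in> curve_points \<Phi>" "h \<in> fun_field \<Phi>" "h \<noteq> 0"
  shows "h ^ n \<in> fun_field \<Phi> \<and> v (h ^ n) = int n * v h"
proof (induction n)
  case 0
  show ?case
    using curve_points_const[OF assms(1), of 1] fun_field_poly[of 1]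
    by (simp add: ff_const_eq one_pCons[symmetric] del: fun_field_poly)
next
  case (Suc n)
  then show ?case
    using assms by (simp add: curve_points_mult algebra_simps)
qed

lemma sqrt_at_exists: "\<exists>\<eta>. \<eta>\<^sup>2 = fls_eval (fls_at e) g"
  using g_nonzero by (intro fls_sqrt_exists) (simp add: fls_subdegree_eval_at)

lemma sqrt_infinity_exists: "\<exists>\<eta>. \<eta>\<^sup>2 = fls_eval fls_infinity g"
  using g_nonzero by (intro fls_sqrt_exists) (simp add: fls_subdegree_eval_infinity)

text \<open>The factor \<open>(x - x0)^n\<close> absorbs the poles of \<open>h\<close> above
  \<open>x0\<close>, and elsewhere it alone determines the order. \<open>T\<close> and
  \<open>N\<close> are the unnormalised orders of \<open>x - x0\<close> and of the product.\<close>

lemma place_subdegree: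
  assumes h: "h \<in> fun_field \<Phi>" "h \<noteq> 0"
    and unit: "\<forall>v\<in>curve_points \<Phi>. v (ff_poly [:- x0, 1:]) \<le> 0 \<longrightarrow> v h = 0"
    and bound: "\<forall>v\<in>curve_points \<Phi>. - int n \<le> v h"
    and rep: "represents (h * ff_poly ([:- x0, 1:] ^ n)) A B C"
    and \<eta>: "\<eta>\<^sup>2 = fls_eval \<xi> g" and \<xi>: "\<xi> \<notin> range fls_const"
    and p: "p \<noteq> 0" "fls_subdegree (fls_eval \<xi> p) \<noteq> 0"
  defines "T \<equiv> fls_subdegree (fls_eval \<xi> [:- x0, 1:])"
    and "N \<equiv> fls_subdegree (fls_eval \<xi> A + fls_eval \<xi> B * \<eta>) - fls_subdegree (fls_eval \<xi> C)"
  shows "(T > 0 \<longrightarrow> N \<ge> 0) \<and> (T \<le> 0 \<longrightarrow> N = int n * T)"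
proof -
  let ?t = "ff_poly [:- x0, 1:]"
  obtain v r where v: "v \<in> curve_points \<Phi>" and "r > 0"
    and r: "\<And>h A B C. h \<noteq> 0 \<Longrightarrow> represents h A B C \<Longrightarrow>
      r * v h = fls_subdegree (fls_eval \<xi> A + fls_eval \<xi> B * \<eta>) - fls_subdegree (fls_eval \<xi> C)"
    using place_exists[OF \<eta> \<xi> p] by blast
  have t: "?t \<in> fun_field \<Phi>" "?t \<noteq> 0"
    by simp_all
  have T: "r * v ?t = T"
    using r[OF t(2) represents_poly] by (simp add: T_def)
  have "v (h * ?t ^ n) = v h + int n * v ?t"
    using curve_points_power[OF v t, of n] curve_points_mult[OF v h(1), of "?t ^ n"] h(2) t(2) by auto
  moreover have N: "r * v (h * ?t ^ n) = N"
    using r[OF _ rep] h(2) t(2) by (simp add: N_def)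
  ultimately have N: "N = r * (v h + int n * v ?t)"
    by simp
  show ?thesis
  proof (intro conjI impI)
    assume "T > 0"
    then have "v ?t > 0"
      using T \<open>r > 0\<close> by (metis zero_less_mult_pos)
    then have "int n * 1 \<le> int n * v ?t"
      by (intro mult_left_mono) simp_all
    then have "0 \<le> v h + int n * v ?t"
      using bound v by force
    then show "N \<ge> 0"
      using \<open>r > 0\<close> by (simp add: N)
  next
    assume "T \<le> 0"
    then have "v ?t \<le> 0"
      using T \<open>r > 0\<close> by (metis not_le mult_pos_pos)
    then show "N = int n * T"
      using unit v by (simp add: N T[symmetric])
  qed
qed

lemma represents_cancel:
  assumes "represents h (D * A) (D * B) (D * C)"
  shows "represents h A B C"
proof -
  have "D \<noteq> 0" "C \<noteq> 0" and "ff_poly D * (h * ff_poly C) = ff_poly D * (ff_poly A + ff_poly B * ff_y \<Phi>)"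
    using assms by (auto simp: represents_def algebra_simps)
  then show ?thesis
    by (simp add: represents_def)
qed

text \<open>
  The sum and the difference of the expansions for \<open>\<eta>\<close> and \<open>- \<eta>\<close> bound the orders of \<open>A\<close> and \<open>B y\<close>
  separately. As the roots of \<open>g\<close> are simple, a root of \<open>C\<close> is then a common root of \<open>A\<close> and \<open>B\<close>.
\<close>

lemma represents_integral:
  assumes regular: "\<And>A B C e \<eta>. represents H A B C \<Longrightarrow> \<eta>\<^sup>2 = fls_eval (fls_at e) g \<Longrightarrow>
      fls_subdegree (fls_eval (fls_at e) C) \<le> fls_subdegree (fls_eval (fls_at e) A + fls_eval (fls_at e) B * \<eta>)"
    and rep: "represents H A B C"
  shows "\<exists>A B. represents H A B 1"
  using rep
proof (induction "Polynomial.degree C" arbitrary: A B C)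
  case 0
  then obtain c where c: "C = [:c:]"
    by (metis degree_eq_zeroE)
  then have "c \<noteq> 0"
    using 0(2) by (simp add: represents_def)
  then have "[:c:] * [:1 / c:] = 1"
    by (simp add: one_pCons)
  then have "represents H (C * ([:1 / c:] * A)) (C * ([:1 / c:] * B)) (C * 1)"
    using 0(2) unfolding c by (simp only: mult.assoc[symmetric] mult_1 mult_1_right)
  then show ?case
    using represents_cancel by blast
next
  case (Suc d)
  obtain e where e: "poly C e = 0"
    using alg_closed_imp_poly_has_root[of C] Suc.hyps(2) by auto
  have "C \<noteq> 0"
    using Suc.prems by (simp add: represents_def)
  then have ord_C: "Polynomial.order e C \<ge> 1"
    using e by (metis One_nat_def Suc_leI neq0_conv order_root)
  let ?ev = "fls_eval (fls_at e)"
  obtain \<eta> where \<eta>: "\<eta>\<^sup>2 = ?ev g"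
    using sqrt_at_exists by blast
  have reg: "fls_subdegree (?ev C) \<le> fls_subdegree (?ev A + ?ev B * \<eta>)"
    "fls_subdegree (?ev C) \<le> fls_subdegree (?ev A - ?ev B * \<eta>)"
    using regular[OF Suc.prems \<eta>] regular[OF Suc.prems, of "- \<eta>" e] \<eta> by simp_all
  have "poly A e = 0"
  proof (cases "A = 0")
    case False
    then have "?ev A \<noteq> 0"
      using fls_eval_nonzero[OF fls_at_not_const] by blast
    then have "fls_subdegree (?ev C) \<le> fls_subdegree (?ev A)"
      by (intro two_times_fls_subdegree_ge[OF _ _ reg]) simp_all
    then have "Polynomial.order e A \<ge> 1"
      using ord_C \<open>C \<noteq> 0\<close> False by (simp add: fls_subdegree_eval_at)
    then show ?thesis
      by (metis False not_one_le_zero order_root)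
  qed simp
  moreover have "poly B e = 0"
  proof (cases "B = 0")
    case False
    then have "?ev B \<noteq> 0" "?ev g \<noteq> 0"
      using fls_eval_nonzero[OF fls_at_not_const] g_nonzero by blast+
    then have "\<eta> \<noteq> 0"
      using \<eta> by auto
    then have "2 * fls_subdegree \<eta> = fls_subdegree (?ev g)"
      unfolding \<eta>[symmetric] by (simp add: power2_eq_square)
    then have sub_\<eta>: "fls_subdegree \<eta> = int (Polynomial.order e g)"
      using g_nonzero by (simp add: fls_subdegree_eval_at)
    have "fls_subdegree (?ev C) \<le> fls_subdegree (?ev B * \<eta>)"
      using \<open>?ev B \<noteq> 0\<close> \<open>\<eta> \<noteq> 0\<close>
      by (intro two_times_fls_subdegree_ge[OF _ _ reg(1) reg(2)[unfolded fls_subdegree_minus_sym[of "?ev A"]]]) simp_all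
    then have "2 * Polynomial.order e C \<le> 2 * Polynomial.order e B + Polynomial.order e g"
      using \<open>C \<noteq> 0\<close> False \<open>?ev B \<noteq> 0\<close> \<open>\<eta> \<noteq> 0\<close> by (simp add: fls_subdegree_eval_at sub_\<eta>)
    moreover have "Polynomial.order e g \<le> 1"
      using squarefree unfolding rsquarefree_def by (metis le_numeral_extra(4) zero_le_one)
    ultimately have "Polynomial.order e B \<ge> 1"
      using ord_C by linarith
    then show ?thesis
      by (metis False not_one_le_zero order_root)
  qed simp
  ultimately obtain A' B' C' where ABC: "A = [:- e, 1:] * A'" "B = [:- e, 1:] * B'" "C = [:- e, 1:] * C'"
    using e unfolding poly_eq_0_iff_dvd dvd_def by blast
  then have "represents H A' B' C'"
    using Suc.prems represents_cancel by blast
  moreover have "C' \<noteq> 0"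
    using ABC \<open>C \<noteq> 0\<close> by auto
  then have "Polynomial.degree C = Suc (Polynomial.degree C')"
    unfolding ABC(3) by (subst degree_mult_eq) simp_all
  ultimately show ?case
    using Suc.hyps by simp
qed

text \<open>The product \<open>H\<close> of \<open>h\<close> and \<open>(x - x0)^n\<close> has no
  finite poles, so it is \<open>A + B y\<close>. Its norm has no root other than \<open>x0\<close>,
  and the order at infinity fixes its degree as \<open>2 n\<close>.\<close>

lemma pell_of_divisor:
  assumes h: "h \<in> fun_field \<Phi>" "h \<noteq> 0"
    and unit: "\<forall>v\<in>curve_points \<Phi>. v (ff_poly [:- x0, 1:]) \<le> 0 \<longrightarrow> v h = 0"
    and bound: "\<forall>v\<in>curve_points \<Phi>. - int n \<le> v h"
  shows "\<exists>A B. h * ff_poly ([:- x0, 1:] ^ n) = ff_poly A + ff_poly B * ff_y \<Phi> \<and>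
    (B \<noteq> 0 \<longrightarrow> pell_solution g x0 n A B) \<and> (B = 0 \<longrightarrow> (\<exists>c. h = ff_const c))"
proof -
  define t where "t = [:- x0, 1:]"
  define H where "H = h * ff_poly (t ^ n)"
  have H: "H \<in> fun_field \<Phi>" "H \<noteq> 0"
    using h by (simp_all add: H_def t_def del: ff_poly_power)
  note sub = place_subdegree[of h x0 n, OF h unit bound, folded t_def, folded H_def]
  have at: "fls_subdegree (fls_eval (fls_at e) t) = (if e = x0 then 2 else 0)" for e
  proof (cases "e = x0")
    case True
    then show ?thesis
      unfolding t_def using fls_eval_at_linear[of e] by simp
  next
    case False
    then show ?thesis
      unfolding t_def using fls_subdegree_eval_at_unit[of "[:- x0, 1:]" e] by simp
  qed
  have at_p: "fls_subdegree (fls_eval (fls_at e) [:- e, 1:]) \<noteq> 0" for e :: "'k alg_closure"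
    unfolding fls_eval_at_linear by simp
  have "fls_subdegree (fls_eval (fls_at e) C) \<le> fls_subdegree (fls_eval (fls_at e) A + fls_eval (fls_at e) B * \<eta>)"
    if "represents H A B C" "\<eta>\<^sup>2 = fls_eval (fls_at e) g" for A B C e \<eta>
    using sub[OF that fls_at_not_const _ at_p] unfolding at by (simp split: if_splits)
  note regular = this
  obtain A\<^sub>0 B\<^sub>0 C\<^sub>0 where rep\<^sub>0: "represents H A\<^sub>0 B\<^sub>0 C\<^sub>0"
    using H(1) fun_field_iff by blast
  have "\<exists>A B. represents H A B 1"
    by (rule represents_integral[OF _ rep\<^sub>0]) (rule regular)
  then obtain A B where rep: "represents H A B 1"
    by blast
  define N where "N = A\<^sup>2 - g * B\<^sup>2"
  have "N \<noteq> 0"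
    using represents_inverse[OF rep H(2)] by (simp add: represents_def N_def)
  have ev_N: "fls_eval \<xi> N = (fls_eval \<xi> A + fls_eval \<xi> B * \<eta>) * (fls_eval \<xi> A - fls_eval \<xi> B * \<eta>)"
    if "\<eta>\<^sup>2 = fls_eval \<xi> g" for \<xi> \<eta>
    by (simp add: N_def that[symmetric] power2_eq_square algebra_simps)
  have sub_N: "fls_subdegree (fls_eval \<xi> N) =
      fls_subdegree (fls_eval \<xi> A + fls_eval \<xi> B * \<eta>) + fls_subdegree (fls_eval \<xi> A - fls_eval \<xi> B * \<eta>)"
    if "\<eta>\<^sup>2 = fls_eval \<xi> g" "\<xi> \<notin> range fls_const" for \<xi> \<eta>
    using fls_eval_nonzero[OF that(2) \<open>N \<noteq> 0\<close>] unfolding ev_N[OF that(1)] by simp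
  \<comment> \<open>Away from \<open>x0\<close>, the expansions of \<open>H\<close> for
    \<open>\<eta>\<close> and \<open>- \<eta>\<close> both have order zero, hence so has their
    product, the norm.\<close>
  have N_root: "poly N e \<noteq> 0" if "e \<noteq> x0" for e
  proof -
    obtain \<eta> where \<eta>: "\<eta>\<^sup>2 = fls_eval (fls_at e) g" "(- \<eta>)\<^sup>2 = fls_eval (fls_at e) g"
      using sqrt_at_exists[of e] by auto
    have "fls_subdegree (fls_eval (fls_at e) N) = 0"
      using sub[OF rep \<eta>(1) fls_at_not_const _ at_p] sub[OF rep \<eta>(2) fls_at_not_const _ at_p] that
      unfolding sub_N[OF \<eta>(1) fls_at_not_const] at by simp
    then have "Polynomial.order e N = 0"
      using \<open>N \<noteq> 0\<close> by (simp add: fls_subdegree_eval_at)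
    then show ?thesis
      using \<open>N \<noteq> 0\<close> by (simp add: order_root)
  qed
  obtain \<eta> where \<eta>: "\<eta>\<^sup>2 = fls_eval fls_infinity g" "(- \<eta>)\<^sup>2 = fls_eval fls_infinity g"
    using sqrt_infinity_exists by auto
  let ?ev = "fls_eval fls_infinity"
  have inf_t: "fls_subdegree (?ev t) = - 2" "t \<noteq> 0"
    using fls_subdegree_eval_infinity[of t] by (simp_all add: t_def)
  \<comment> \<open>Both conjugate expansions have the order of \<open>(x - x0)^n\<close>. Their
    product gives the degree of the norm; their sum and difference bound the degrees of
    \<open>A\<close> and \<open>B\<close>.\<close>
  have inf: "fls_subdegree (?ev A + ?ev B * \<eta>) = - 2 * int n" "fls_subdegree (?ev A - ?ev B * \<eta>) = - 2 * int n"
    using sub[OF rep \<eta>(1) fls_infinity_not_const inf_t(2)] sub[OF rep \<eta>(2) fls_infinity_not_const inf_t(2)]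
    unfolding inf_t(1) by simp_all
  have deg_N: "Polynomial.degree N = 2 * n"
    using sub_N[OF \<eta>(1) fls_infinity_not_const] \<open>N \<noteq> 0\<close> unfolding inf
    by (simp add: fls_subdegree_eval_infinity)
  have deg_A: "Polynomial.degree A \<le> n"
  proof (cases "A = 0")
    case False
    then have "- 2 * int n \<le> fls_subdegree (?ev A)"
      using fls_subdegree_eval_infinity[OF False]
      by (intro two_times_fls_subdegree_ge[OF _ _ inf[THEN eq_refl[OF sym]]]) simp_all
    then show ?thesis
      using fls_subdegree_eval_infinity[OF False] by simp
  qed simp
  have deg_B: "2 * Polynomial.degree B + Polynomial.degree g \<le> 2 * n" if "B \<noteq> 0"
  proof -
    note B = fls_subdegree_eval_infinity[OF that] and g = fls_subdegree_eval_infinity[OF g_nonzero]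
    have "\<eta> \<noteq> 0"
      using \<eta>(1) g by auto
    then have "2 * fls_subdegree \<eta> = fls_subdegree (?ev g)"
      unfolding \<eta>(1)[symmetric] by (simp add: power2_eq_square)
    then have sub_\<eta>: "fls_subdegree \<eta> = - int (Polynomial.degree g)"
      using g by simp
    have "- 2 * int n \<le> fls_subdegree (?ev B * \<eta>)"
      using B \<open>\<eta> \<noteq> 0\<close>
      by (intro two_times_fls_subdegree_ge[OF _ _ inf(1)[THEN eq_refl[OF sym]]
            inf(2)[unfolded fls_subdegree_minus_sym[of "?ev A"], THEN eq_refl[OF sym]]]) simp_all
    then show ?thesis
      using B sub_\<eta> \<open>\<eta> \<noteq> 0\<close> by simp
  qed
  obtain q where q: "N = t ^ Polynomial.order x0 N * q" "\<not> t dvd q"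
    unfolding t_def using order_decomp[OF \<open>N \<noteq> 0\<close>] by blast
  have "poly q e \<noteq> 0" for e
  proof (cases "e = x0")
    case True
    then show ?thesis
      using q(2) by (simp add: poly_eq_0_iff_dvd t_def)
  next
    case False
    then show ?thesis
      using N_root[OF False] by (subst (asm) q(1)) auto
  qed
  then have "Polynomial.degree q = 0"
    using alg_closed_imp_poly_has_root[of q] by auto
  then obtain c where c: "q = [:c:]"
    by (metis degree_eq_zeroE)
  have "c \<noteq> 0"
    using \<open>\<And>e. poly q e \<noteq> 0\<close> c by simp
  have N_eq: "N = Polynomial.smult c (t ^ Polynomial.order x0 N)"
    by (subst q(1)) (simp add: c)
  then have "Polynomial.degree N = Polynomial.order x0 N"
    using \<open>c \<noteq> 0\<close> by (metis degree_linear_power degree_smult_eq t_def)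
  then have N_eq: "N = Polynomial.smult c (t ^ (2 * n))"
    using N_eq deg_N by simp
  have "pell_solution g x0 n A B" if "B \<noteq> 0"
    unfolding pell_solution_def using that deg_A deg_B N_eq \<open>c \<noteq> 0\<close> by (auto simp: N_def t_def)
  \<comment> \<open>Without a \<open>y\<close>-part, \<open>A^2\<close> is a constant times
    \<open>(t^n)^2\<close>, so \<open>A\<close> is a constant times \<open>t^n\<close> and
    \<open>h\<close> is that constant.\<close>
  moreover have "\<exists>c. h = ff_const c" if "B = 0"
  proof -
    have "A\<^sup>2 = Polynomial.smult c (t ^ (2 * n))"
      using N_eq that by (simp add: N_def)
    also have "\<dots> = Polynomial.smult c ((t ^ n)\<^sup>2)"
      by (simp add: power_mult[symmetric] mult.commute)
    finally have A2: "A\<^sup>2 = Polynomial.smult c ((t ^ n)\<^sup>2)" .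
    obtain a where "a\<^sup>2 = c"
      using nth_root_exists[of 2 c] by auto
    then have "A\<^sup>2 = (Polynomial.smult a (t ^ n))\<^sup>2"
      unfolding A2 by (simp add: power2_eq_square)
    then have "A = Polynomial.smult a (t ^ n) \<or> A = - Polynomial.smult a (t ^ n)"
      by (simp only: power2_eq_iff)
    then have "A = [:a:] * t ^ n \<or> A = [:- a:] * t ^ n"
      by simp
    then obtain b where "A = [:b:] * t ^ n"
      by blast
    then have "ff_poly A = ff_poly [:b:] * ff_poly (t ^ n)"
      by (simp only: ff_poly_simps)
    moreover have "H = ff_poly A"
      using rep that by (simp add: represents_def)
    ultimately have "h * ff_poly (t ^ n) = ff_poly [:b:] * ff_poly (t ^ n)"
      by (simp only: H_def)
    then have "h = ff_poly [:b:]"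
      by (simp add: t_def)
    then show ?thesis
      by (auto simp: ff_const_eq)
  qed
  ultimately show ?thesis
    using rep unfolding represents_def H_def t_def by auto
qed

end

section \<open>Rational points and Galois invariance\<close>

context hyperelliptic
begin

text \<open>Points assign the value \<open>0\<close> to the zero function by convention. The clause
  \<open>h = 0\<close> treats it as having infinite order, which makes these sets closed under
  addition.\<close>

definition val_ge :: "('k ff_closure \<Rightarrow> int) \<Rightarrow> int \<Rightarrow> 'k ff_closure \<Rightarrow> bool" where
  "val_ge v k h \<longleftrightarrow> h \<in> fun_field \<Phi> \<and> (h = 0 \<or> k \<le> v h)"

lemma val_ge_add:
  assumes "v \<in> curve_points \<Phi>" "val_ge v k h" "val_ge v k h'"
  shows "val_ge v k (h + h')"
proof -
  have mem: "h + h' \<in> fun_field \<Phi>"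
    using assms(2,3) by (simp add: val_ge_def)
  show ?thesis
  proof (cases "h = 0 \<or> h' = 0 \<or> h + h' = 0")
    case True
    then show ?thesis
      using assms(2,3) mem by (auto simp: val_ge_def)
  next
    case False
    then have "min (v h) (v h') \<le> v (h + h')" "k \<le> v h" "k \<le> v h'"
      using assms curve_points_add[OF assms(1), of h h'] by (simp_all add: val_ge_def)
    then have "k \<le> v (h + h')"
      by linarith
    then show ?thesis
      using mem by (simp add: val_ge_def)
  qed
qed

lemma val_ge_mult:
  assumes "v \<in> curve_points \<Phi>" "val_ge v k h" "val_ge v k' h'"
  shows "val_ge v (k + k') (h * h')"
  using assms curve_points_mult[OF assms(1), of h h'] unfolding val_ge_def
  by (cases "h = 0"; cases "h' = 0") simp_all

lemma val_ge_const:
  assumes "v \<in> curve_points \<Phi>"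
  shows "val_ge v 0 (ff_poly [:c:])"
  using curve_points_const[OF assms, of c] by (simp add: val_ge_def ff_const_eq)

lemma val_const_plus:
  assumes v: "v \<in> curve_points \<Phi>" and "c \<noteq> 0" and h: "val_ge v 1 h"
  shows "v (ff_poly [:c:] + h) = 0"
proof -
  have ge: "val_ge v 0 (ff_poly [:c:] + h)"
    using h by (intro val_ge_add[OF v val_ge_const[OF v]]) (auto simp: val_ge_def)
  have neg: "val_ge v 1 (ff_poly [:- 1:] * h)"
    using val_ge_mult[OF v val_ge_const[OF v] h] by simp
  have "\<not> val_ge v 1 (ff_poly [:c:] + h)"
  proof
    assume "val_ge v 1 (ff_poly [:c:] + h)"
    then have "val_ge v 1 ((ff_poly [:c:] + h) + ff_poly [:- 1:] * h)"
      using neg by (rule val_ge_add[OF v])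
    moreover have "ff_poly [:- 1:] = (- 1 :: 'k ff_closure)"
      by (metis ff_poly_simps(2,5) one_pCons minus_pCons minus_zero)
    then have "(ff_poly [:c:] + h) + ff_poly [:- 1:] * h = ff_poly [:c:]"
      by (simp only: mult_minus_left mult_1) simp
    ultimately have "val_ge v 1 (ff_poly [:c:])"
      by simp
    then show False
      using curve_points_const[OF v, of c] \<open>c \<noteq> 0\<close> by (simp add: val_ge_def ff_const_eq)
  qed
  then show ?thesis
    using ge by (auto simp: val_ge_def)
qed

section \<open>Valuations centred at an affine point\<close>

definition is_point :: "'k alg_closure \<Rightarrow> 'k alg_closure \<Rightarrow> ('k ff_closure \<Rightarrow> int) \<Rightarrow> bool" where
  "is_point x0 y0 v \<longleftrightarrow> v \<in> curve_points \<Phi> \<and> v (ff_poly [:- x0, 1:]) > 0 \<and>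
     val_ge v 1 (ff_poly [:- y0:] + ff_y \<Phi>)"

lemma is_pointD:
  assumes "is_point x0 y0 v"
  shows "v \<in> curve_points \<Phi>" "v (ff_poly [:- x0, 1:]) > 0" "val_ge v 1 (ff_poly [:- x0, 1:])"
    "val_ge v 1 (ff_poly [:- y0:] + ff_y \<Phi>)"
  using assms by (simp_all add: is_point_def val_ge_def)

text \<open>In the expansion at \<open>x0\<close> the product of \<open>\<eta> - y0\<close> and
  \<open>\<eta> + y0\<close> has positive order, hence so has one factor. Passing to
  \<open>- \<eta>\<close> if necessary selects the place where \<open>y\<close> takes the value
  \<open>y0\<close>.\<close>

lemma point_exists:
  assumes "y0\<^sup>2 = poly g x0"
  shows "\<exists>v. is_point x0 y0 v"
proof -
  let ?ev = "fls_eval (fls_at x0)"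
  obtain \<eta> where \<eta>: "\<eta>\<^sup>2 = ?ev g"
    using sqrt_at_exists by blast
  define p where "p = g - [:y0\<^sup>2:]"
  have "p \<noteq> 0"
    using degree_g by (auto simp: p_def)
  have "poly p x0 = 0"
    using assms by (simp add: p_def)
  then have "Polynomial.order x0 p > 0"
    using \<open>p \<noteq> 0\<close> by (simp add: order_root)
  then have "fls_subdegree (?ev p) > 0"
    using \<open>p \<noteq> 0\<close> by (simp add: fls_subdegree_eval_at)
  moreover have "?ev p = (\<eta> - fls_const y0) * (\<eta> + fls_const y0)"
    by (simp add: p_def \<eta>[symmetric] power2_eq_square algebra_simps)
  moreover have "?ev p \<noteq> 0"
    using fls_eval_nonzero[OF fls_at_not_const \<open>p \<noteq> 0\<close>] .
  ultimately have "fls_subdegree (\<eta> - fls_const y0) + fls_subdegree (\<eta> + fls_const y0) > 0"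
    by simp
  then have "fls_subdegree (\<eta> - fls_const y0) > 0 \<or> fls_subdegree (\<eta> + fls_const y0) > 0"
    by linarith
  moreover have "fls_subdegree (- \<eta> - fls_const y0) = fls_subdegree (\<eta> + fls_const y0)"
    using fls_subdegree_minus_sym[of "- \<eta>" "fls_const y0"] by (simp add: add.commute)
  moreover have "(- \<eta>)\<^sup>2 = ?ev g"
    using \<eta> by simp
  ultimately obtain \<eta>' where \<eta>': "\<eta>'\<^sup>2 = ?ev g" "fls_subdegree (\<eta>' - fls_const y0) > 0"
    using \<eta> by metis
  have t: "fls_subdegree (?ev [:- x0, 1:]) = 2"
    unfolding fls_eval_at_linear by simp
  then obtain v r where v: "v \<in> curve_points \<Phi>" "r > 0"
    and r: "\<And>h A B C. h \<noteq> 0 \<Longrightarrow> represents h A B C \<Longrightarrow>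
      r * v h = fls_subdegree (?ev A + ?ev B * \<eta>') - fls_subdegree (?ev C)"
    using place_exists[OF \<eta>'(1) fls_at_not_const, of "[:- x0, 1:]"] by auto
  have "r * v (ff_poly [:- x0, 1:]) = 2"
    using r[OF _ represents_poly, of "[:- x0, 1:]"] t by simp
  then have "v (ff_poly [:- x0, 1:]) > 0"
    using v(2) by (metis zero_less_mult_pos zero_less_numeral)
  moreover have "val_ge v 1 (ff_poly [:- y0:] + ff_y \<Phi>)"
  proof (cases "ff_poly [:- y0:] + ff_y \<Phi> = 0")
    case False
    have "represents (ff_poly [:- y0:] + ff_y \<Phi>) [:- y0:] 1 1"
      by (simp add: represents_def)
    then have "r * v (ff_poly [:- y0:] + ff_y \<Phi>) = fls_subdegree (?ev [:- y0:] + ?ev 1 * \<eta>') - fls_subdegree (?ev 1)"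
      by (rule r[OF False])
    also have "\<dots> = fls_subdegree (\<eta>' - fls_const y0)"
      by simp
    finally have "r * v (ff_poly [:- y0:] + ff_y \<Phi>) > 0"
      using \<eta>'(2) by simp
    then have "v (ff_poly [:- y0:] + ff_y \<Phi>) > 0"
      using v(2) by (metis zero_less_mult_pos)
    then show ?thesis
      by (simp add: val_ge_def)
  qed (simp add: val_ge_def)
  ultimately show ?thesis
    using v(1) unfolding is_point_def by blast
qed

lemma val_ge_poly:
  assumes "is_point x0 y0 v"
  shows "val_ge v 0 (ff_poly p)"
proof -
  note v = is_pointD[OF assms]
  have "val_ge v 0 (ff_poly [:- x0, 1:] + ff_poly [:x0:])"
    using v by (intro val_ge_add val_ge_const) (auto simp: val_ge_def)
  then have x: "val_ge v 0 (ff_poly [:0, 1:])"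
    unfolding ff_poly_simps(3)[symmetric] by simp
  show ?thesis
  proof (induction p)
    case 0
    show ?case
      by (simp add: val_ge_def)
  next
    case (pCons a p)
    have "pCons a p = [:a:] + [:0, 1:] * p"
      by simp
    moreover have "val_ge v 0 (ff_poly ([:a:] + [:0, 1:] * p))"
      using val_ge_add[OF v(1) val_ge_const[OF v(1), of a] val_ge_mult[OF v(1) x pCons.IH, simplified add_0]]
      by (simp only: ff_poly_simps)
    ultimately show ?case
      by (simp only:)
  qed
qed

text \<open>Modulo functions of positive order, \<open>x\<close> and \<open>y\<close> may be
  replaced by \<open>x0\<close> and \<open>y0\<close>, which leaves a nonzero constant.\<close>

lemma val_unit:
  assumes "is_point x0 y0 v" and "poly A x0 + poly B x0 * y0 \<noteq> 0"
  shows "v (ff_poly A + ff_poly B * ff_y \<Phi>) = 0"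
proof -
  note v = is_pointD[OF assms(1)]
  let ?t = "ff_poly [:- x0, 1:]" and ?s = "ff_poly [:- y0:] + ff_y \<Phi>"
  define A' B' where "A' = synthetic_div A x0" and "B' = synthetic_div B x0"
  have "A = [:- x0, 1:] * A' + [:poly A x0:]" "B = [:- x0, 1:] * B' + [:poly B x0:]"
    unfolding A'_def B'_def by (rule synthetic_div_correct'[symmetric])+
  then have AB: "ff_poly A = ?t * ff_poly A' + ff_poly [:poly A x0:]" "ff_poly B = ?t * ff_poly B' + ff_poly [:poly B x0:]"
    by (metis ff_poly_simps(3,6))+
  have c: "ff_poly [:poly A x0 + poly B x0 * y0:] = ff_poly [:poly A x0:] + ff_poly [:poly B x0:] * ff_poly [:y0:]"
    unfolding ff_poly_simps(3,6)[symmetric] by simp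
  have y0: "ff_poly [:- y0:] = - ff_poly [:y0:]"
    unfolding ff_poly_simps(5)[symmetric] by simp
  have "ff_poly A + ff_poly B * ff_y \<Phi> = ff_poly [:poly A x0 + poly B x0 * y0:] +
      (?t * ff_poly A' + (ff_poly B * ?s + ?t * (ff_poly B' * ff_poly [:y0:])))"
    unfolding c y0 AB by (simp add: algebra_simps)
  moreover have "val_ge v 1 (?t * ff_poly A' + (ff_poly B * ?s + ?t * (ff_poly B' * ff_poly [:y0:])))"
    using val_ge_mult[OF v(1) v(3) val_ge_poly[OF assms(1), of A']]
      val_ge_mult[OF v(1) val_ge_poly[OF assms(1), of B] v(4)]
      val_ge_mult[OF v(1) v(3) val_ge_poly[OF assms(1), of "B' * [:y0:]"]]
    by (intro val_ge_add[OF v(1)]) (simp_all only: ff_poly_simps add_0_right add_0)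
  ultimately show ?thesis
    using val_const_plus[OF v(1) assms(2)] by simp
qed

lemma val_poly_at_point:
  assumes "p \<noteq> 0" and "is_point x0 y0 v"
  shows "v (ff_poly p) = int (Polynomial.order x0 p) * v (ff_poly [:- x0, 1:])"
proof -
  note v = is_pointD[OF assms(2)]
  obtain q where q: "p = [:- x0, 1:] ^ Polynomial.order x0 p * q" "\<not> [:- x0, 1:] dvd q"
    using order_decomp[OF assms(1)] by blast
  then have "poly q x0 \<noteq> 0"
    by (simp add: poly_eq_0_iff_dvd)
  then have "v (ff_poly q + ff_poly 0 * ff_y \<Phi>) = 0" "q \<noteq> 0"
    using val_unit[OF assms(2), of q 0] by auto
  then have "v (ff_poly q) = 0"
    by simp
  have "v (ff_poly p) = v (ff_poly [:- x0, 1:] ^ Polynomial.order x0 p * ff_poly q)"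
    by (subst q(1)) simp
  also have "\<dots> = v (ff_poly [:- x0, 1:] ^ Polynomial.order x0 p) + v (ff_poly q)"
    using v(1) curve_points_power[OF v(1), of "ff_poly [:- x0, 1:]"] \<open>q \<noteq> 0\<close>
    by (intro curve_points_mult[OF v(1)]) simp_all
  also have "\<dots> = int (Polynomial.order x0 p) * v (ff_poly [:- x0, 1:])"
    using curve_points_power[OF v(1), of "ff_poly [:- x0, 1:]"] \<open>v (ff_poly q) = 0\<close> by simp
  finally show ?thesis .
qed

text \<open>For \<open>y0 \<noteq> 0\<close> the function \<open>x - x0\<close> is a uniformiser. It
  is essential that \<open>k\<close> does not depend on \<open>v\<close>: this is what later makes
  the point unique.\<close>

lemma val_at_point_integral:
  assumes "y0 \<noteq> 0" and "A \<noteq> 0 \<or> B \<noteq> 0"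
  shows "\<exists>k. \<forall>v. is_point x0 y0 v \<longrightarrow>
    v (ff_poly A + ff_poly B * ff_y \<Phi>) = k * v (ff_poly [:- x0, 1:])"
  using assms(2)
proof (induction "Polynomial.degree A + Polynomial.degree B" arbitrary: A B rule: less_induct)
  case less
  let ?t = "[:- x0, 1:]"
  have N: "A\<^sup>2 - g * B\<^sup>2 \<noteq> 0"
    using norm_eq_0D[of A B] less.prems by auto
  have nz: "ff_poly A + ff_poly B * ff_y \<Phi> \<noteq> 0" if "A \<noteq> 0 \<or> B \<noteq> 0" for A B
    using ff_sum_eq_0D[of A B] that by auto
  \<comment> \<open>If \<open>A + B y\<close> and its conjugate both vanish at the point, then
    \<open>A\<close> and \<open>B\<close> vanish at \<open>x0\<close> since
    \<open>y0 \<noteq> 0\<close>, and \<open>x - x0\<close> can be cancelled. In the third case the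
    conjugate is a unit, and the order is that of the norm.\<close>
  consider "poly A x0 = 0" "poly B x0 = 0" | "poly A x0 + poly B x0 * y0 \<noteq> 0"
    | "poly A x0 + poly (- B) x0 * y0 \<noteq> 0"
    using assms(1) by (fastforce simp: add_eq_0_iff)
  then show ?case
  proof cases
    case 1
    then obtain A' B' where AB: "A = ?t * A'" "B = ?t * B'"
      unfolding poly_eq_0_iff_dvd dvd_def by blast
    then have nz': "A' \<noteq> 0 \<or> B' \<noteq> 0"
      using less.prems by auto
    have "Polynomial.degree A = (if A' = 0 then 0 else Suc (Polynomial.degree A'))"
      "Polynomial.degree B = (if B' = 0 then 0 else Suc (Polynomial.degree B'))"
      using degree_mult_eq[of ?t A'] degree_mult_eq[of ?t B'] unfolding AB by simp_all
    then have "Polynomial.degree A' + Polynomial.degree B' < Polynomial.degree A + Polynomial.degree B"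
      using nz' by auto
    then obtain k where k: "\<And>v. is_point x0 y0 v \<Longrightarrow> v (ff_poly A' + ff_poly B' * ff_y \<Phi>) = k * v (ff_poly ?t)"
      using less.hyps nz' by blast
    have "v (ff_poly A + ff_poly B * ff_y \<Phi>) = (1 + k) * v (ff_poly ?t)" if v: "is_point x0 y0 v" for v
    proof -
      have "ff_poly A + ff_poly B * ff_y \<Phi> = ff_poly ?t * (ff_poly A' + ff_poly B' * ff_y \<Phi>)"
        unfolding AB ff_poly_simps(6) by (simp only: distrib_left mult.assoc)
      then have "v (ff_poly A + ff_poly B * ff_y \<Phi>) = v (ff_poly ?t) + v (ff_poly A' + ff_poly B' * ff_y \<Phi>)"
        using curve_points_mult[OF is_pointD(1)[OF v], of "ff_poly ?t" "ff_poly A' + ff_poly B' * ff_y \<Phi>"] nz[OF nz']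
        by simp
      then show ?thesis
        using k[OF v] by (simp add: algebra_simps)
    qed
    then show ?thesis
      by blast
  next
    case 2
    then show ?thesis
      by (intro exI[of _ 0]) (simp add: val_unit)
  next
    case 3
    have "v (ff_poly A + ff_poly B * ff_y \<Phi>) = int (Polynomial.order x0 (A\<^sup>2 - g * B\<^sup>2)) * v (ff_poly ?t)"
      if v: "is_point x0 y0 v" for v
    proof -
      have "(ff_poly A + ff_poly B * ff_y \<Phi>) * (ff_poly A + ff_poly (- B) * ff_y \<Phi>)
          = ff_poly A * ff_poly A - ff_poly B * ff_poly B * (ff_y \<Phi> * ff_y \<Phi>)"
        by (simp add: algebra_simps)
      also have "\<dots> = ff_poly (A\<^sup>2 - g * B\<^sup>2)"
        by (simp add: y_mult_y power2_eq_square mult.commute mult.left_commute)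
      finally have "v (ff_poly (A\<^sup>2 - g * B\<^sup>2)) =
          v (ff_poly A + ff_poly B * ff_y \<Phi>) + v (ff_poly A + ff_poly (- B) * ff_y \<Phi>)"
        using curve_points_mult[OF is_pointD(1)[OF v], of "ff_poly A + ff_poly B * ff_y \<Phi>" "ff_poly A + ff_poly (- B) * ff_y \<Phi>"]
          nz[of A B] nz[of A "- B"] less.prems by (simp del: ff_poly_simps(5))
      then show ?thesis
        using val_unit[OF v 3] val_poly_at_point[OF N v] by simp
    qed
    then show ?thesis
      by blast
  qed
qed

lemma val_at_point:
  assumes "y0 \<noteq> 0" and "h \<in> fun_field \<Phi>"
  shows "\<exists>k. \<forall>v. is_point x0 y0 v \<longrightarrow> v h = k * v (ff_poly [:- x0, 1:])"
proof (cases "h = 0")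
  case True
  then show ?thesis
    by (intro exI[of _ 0]) (auto simp: is_point_def curve_points_def)
next
  case False
  obtain A B C where "C \<noteq> 0" and h: "h * ff_poly C = ff_poly A + ff_poly B * ff_y \<Phi>"
    using assms(2) fun_field_iff unfolding represents_def by blast
  then have "A \<noteq> 0 \<or> B \<noteq> 0"
    using False by auto
  then obtain k where k: "\<And>v. is_point x0 y0 v \<Longrightarrow> v (h * ff_poly C) = k * v (ff_poly [:- x0, 1:])"
    using val_at_point_integral[OF assms(1)] unfolding h by blast
  have "v h = (k - int (Polynomial.order x0 C)) * v (ff_poly [:- x0, 1:])" if v: "is_point x0 y0 v" for v
    using k[OF v] val_poly_at_point[OF \<open>C \<noteq> 0\<close> v] False \<open>C \<noteq> 0\<close>
      curve_points_mult[OF is_pointD(1)[OF v] assms(2), of "ff_poly C"]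
    by (simp add: algebra_simps)
  then show ?thesis
    by blast
qed

text \<open>Some function has value \<open>1\<close>, and all values are multiples of that of
  \<open>x - x0\<close>. So \<open>x - x0\<close> has value \<open>1\<close>, and
  \<open>val_at_point\<close> determines every other value.\<close>

lemma point_unique:
  assumes "y0 \<noteq> 0" and v: "is_point x0 y0 v" and v': "is_point x0 y0 v'"
  shows "v = v'"
proof
  fix h
  have t: "u (ff_poly [:- x0, 1:]) = 1" if u: "is_point x0 y0 u" for u
  proof -
    obtain h where "h \<in> fun_field \<Phi>" "u h = 1"
      using is_pointD(1)[OF u] by (auto simp: curve_points_def)
    then have "u (ff_poly [:- x0, 1:]) dvd 1"
      using val_at_point[OF assms(1)] u by (metis dvd_triv_right)
    then show ?thesis
      using is_pointD(2)[OF u] by auto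
  qed
  show "v h = v' h"
  proof (cases "h \<in> fun_field \<Phi>")
    case True
    then show ?thesis
      using val_at_point[OF assms(1) True, of x0] t[OF v] t[OF v'] v v' by metis
  next
    case False
    then show ?thesis
      using is_pointD(1)[OF v] is_pointD(1)[OF v'] by (simp add: curve_points_def)
  qed
qed

end

section \<open>Galois action on points and divisors\<close>

lemma galois_liftsD:
  assumes "\<tau> \<in> galois_lifts \<Phi>"
  shows "bij_betw \<tau> (fun_field \<Phi>) (fun_field \<Phi>)"
    and "\<And>g h. g \<in> fun_field \<Phi> \<Longrightarrow> h \<in> fun_field \<Phi> \<Longrightarrow> \<tau> (g + h) = \<tau> g + \<tau> h"
    and "\<And>g h. g \<in> fun_field \<Phi> \<Longrightarrow> h \<in> fun_field \<Phi> \<Longrightarrow> \<tau> (g * h) = \<tau> g * \<tau> h"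
    and "\<tau> ff_x = ff_x" and "\<tau> (ff_y \<Phi>) = ff_y \<Phi>"
    and "\<And>c. \<exists>c'. \<tau> (ff_const c) = ff_const c'"
    and "\<And>c. \<tau> (ff_const (to_ac c)) = ff_const (to_ac c)"
  using assms unfolding galois_lifts_def absolute_galois_def by auto

context hyperelliptic
begin

lemma galois_lift_mem:
  assumes "\<tau> \<in> galois_lifts \<Phi>" and "h \<in> fun_field \<Phi>"
  shows "\<tau> h \<in> fun_field \<Phi>"
  using galois_liftsD(1)[OF assms(1)] assms(2) by (auto simp: bij_betw_def)

lemma galois_lift_0:
  assumes "\<tau> \<in> galois_lifts \<Phi>"
  shows "\<tau> 0 = 0"
  using galois_liftsD(2)[OF assms, of 0 0] by (metis add_0 add_cancel_right_left fun_field_0)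

lemma galois_lift_eq_0_iff:
  assumes "\<tau> \<in> galois_lifts \<Phi>" and "h \<in> fun_field \<Phi>"
  shows "\<tau> h = 0 \<longleftrightarrow> h = 0"
  using galois_liftsD(1)[OF assms(1)] galois_lift_0[OF assms(1)] assms(2)
  by (metis bij_betw_def fun_field_0 inj_on_eq_iff)

lemma galois_lift_image:
  assumes "\<tau> \<in> galois_lifts \<Phi>"
  shows "\<tau> ` (fun_field \<Phi> - {0}) = fun_field \<Phi> - {0}"
proof -
  have "\<tau> ` (fun_field \<Phi> - {0}) = \<tau> ` fun_field \<Phi> - \<tau> ` {0}"
    using galois_liftsD(1)[OF assms] by (intro inj_on_image_set_diff) (auto simp: bij_betw_def)
  then show ?thesis
    using galois_liftsD(1)[OF assms] galois_lift_0[OF assms] by (simp add: bij_betw_def)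
qed

lemma act_point_curve_points:
  assumes \<tau>: "\<tau> \<in> galois_lifts \<Phi>" and v: "v \<in> curve_points \<Phi>"
  shows "act_point \<Phi> \<tau> v \<in> curve_points \<Phi>"
  unfolding curve_points_def mem_Collect_eq
proof (intro conjI allI ballI impI)
  note D = galois_liftsD[OF \<tau>]
  note mem = galois_lift_mem[OF \<tau>] and nz = galois_lift_eq_0_iff[OF \<tau>]
  let ?F = "fun_field \<Phi> - {0}"
  {
    fix h assume "h \<notin> ?F"
    then show "act_point \<Phi> \<tau> v h = 0"
      using v galois_lift_0[OF \<tau>] by (auto simp: act_point_def curve_points_def)
  next
    fix g h assume "g \<in> ?F" "h \<in> ?F"
    then show "act_point \<Phi> \<tau> v (g * h) = act_point \<Phi> \<tau> v g + act_point \<Phi> \<tau> v h"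
      using curve_points_mult[OF v mem mem] by (simp add: act_point_def D(3) nz)
  next
    fix g h assume gh: "g \<in> ?F" "h \<in> ?F" "g + h \<noteq> 0"
    then have "\<tau> g + \<tau> h \<noteq> 0"
      using nz[of "g + h"] D(2)[of g h] by auto
    then show "min (act_point \<Phi> \<tau> v g) (act_point \<Phi> \<tau> v h) \<le> act_point \<Phi> \<tau> v (g + h)"
      using gh curve_points_add[OF v mem mem, of g h] by (simp add: act_point_def D(2) nz)
  next
    fix c
    show "act_point \<Phi> \<tau> v (ff_const c) = 0"
      using D(6)[of c] curve_points_const[OF v] by (auto simp: act_point_def)
  next
    obtain h where "h \<in> fun_field \<Phi>" "v h = 1"
      using v by (auto simp: curve_points_def)
    moreover obtain h' where "h' \<in> fun_field \<Phi>" "h = \<tau> h'"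
      using D(1) \<open>h \<in> fun_field \<Phi>\<close> by (auto simp: bij_betw_def)
    ultimately show "\<exists>h\<in>fun_field \<Phi>. act_point \<Phi> \<tau> v h = 1"
      by (auto simp: act_point_def)
  }
qed

lemma act_point_inj:
  assumes \<tau>: "\<tau> \<in> galois_lifts \<Phi>" and v: "v \<in> curve_points \<Phi>" "v' \<in> curve_points \<Phi>"
    and eq: "act_point \<Phi> \<tau> v = act_point \<Phi> \<tau> v'"
  shows "v = v'"
proof
  fix h
  show "v h = v' h"
  proof (cases "h \<in> fun_field \<Phi>")
    case True
    then obtain h' where "h' \<in> fun_field \<Phi>" "h = \<tau> h'"
      using galois_liftsD(1)[OF \<tau>] by (auto simp: bij_betw_def)
    then show ?thesis
      using fun_cong[OF eq, of h'] by (simp add: act_point_def)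
  qed (use v in \<open>simp add: curve_points_def\<close>)
qed

text \<open>For rational coordinates \<open>\<tau>\<close> fixes \<open>x - x0\<close> and
  \<open>y - y0\<close>, so the moved valuation has the same centre and \<open>point_unique\<close>
  applies.\<close>

lemma act_point_rational:
  assumes \<tau>: "\<tau> \<in> galois_lifts \<Phi>" and "y0 \<noteq> 0" and v: "is_point (to_ac x0) (to_ac y0) v"
  shows "act_point \<Phi> \<tau> v = v"
proof -
  note D = galois_liftsD[OF \<tau>]
  have neg: "\<tau> (ff_poly [:- to_ac c:]) = ff_poly [:- to_ac c:]" for c
    using D(7)[of "- c"] by (simp add: ff_const_eq)
  have "\<tau> (ff_poly [:- to_ac x0:] + ff_poly [:0, 1:]) = ff_poly [:- to_ac x0:] + ff_poly [:0, 1:]"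
    using D(4) by (simp add: D(2) neg ff_x_eq)
  then have "\<tau> (ff_poly [:- to_ac x0, 1:]) = ff_poly [:- to_ac x0, 1:]"
    unfolding ff_poly_simps(3)[symmetric] by simp
  moreover have "\<tau> (ff_poly [:- to_ac y0:] + ff_y \<Phi>) = ff_poly [:- to_ac y0:] + ff_y \<Phi>"
    by (simp add: D(2,5) neg)
  ultimately have "is_point (to_ac x0) (to_ac y0) (act_point \<Phi> \<tau> v)"
    using v act_point_curve_points[OF \<tau>] by (simp add: is_point_def val_ge_def act_point_def)
  then show ?thesis
    using point_unique[of "to_ac y0"] assms(2) v by simp
qed

section \<open>Divisor classes and a class of infinite order\<close>

lemma principal_divisor_mult:
  assumes "h \<in> fun_field \<Phi> - {0}" "h' \<in> fun_field \<Phi> - {0}"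
  shows "principal_divisor \<Phi> (h * h') v = principal_divisor \<Phi> h v + principal_divisor \<Phi> h' v"
  using assms curve_points_mult[of v \<Phi> h h'] by (simp add: principal_divisor_def)

lemma principal_divisor_1: "principal_divisor \<Phi> 1 v = 0"
  using curve_points_const[of v \<Phi> 1] by (simp add: principal_divisor_def ff_const_eq one_pCons[symmetric])

text \<open>The coset of \<open>E\<close> modulo principal divisors, as an explicit set.\<close>

definition translate :: "'k divisor \<Rightarrow> 'k divisor set" where
  "translate E = (\<lambda>h v. principal_divisor \<Phi> h v + E v) ` (fun_field \<Phi> - {0})"

text \<open>Multiplying functions adds their divisors, and the function \<open>1\<close> supplies
  the zero divisor. For \<open>n = 0\<close> both sides are the set of principal divisors.\<close>

lemma jacobian_points_power:
  "translate E [^]\<^bsub>jacobian_points \<Phi>\<^esub> (n::nat) = translate (\<lambda>v. int n * E v)"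
proof (induction n)
  case 0
  show ?case
    by (simp add: jacobian_points_def pic0_group_def FactGroup_def nat_pow_def translate_def image_def)
next
  case (Suc n)
  let ?F = "fun_field \<Phi> - {0}"
  have "translate E [^]\<^bsub>jacobian_points \<Phi>\<^esub> Suc n =
      translate (\<lambda>v. int n * E v) <#>\<^bsub>div0_group \<Phi>\<^esub> translate E"
    using Suc.IH by (simp add: jacobian_points_def pic0_group_def FactGroup_def nat_pow_def)
  also have "\<dots> = translate (\<lambda>v. int (Suc n) * E v)"
  proof (intro equalityI subsetI)
    fix A assume "A \<in> translate (\<lambda>v. int n * E v) <#>\<^bsub>div0_group \<Phi>\<^esub> translate E"
    then obtain g h where gh: "g \<in> ?F" "h \<in> ?F"
      and A: "A = (\<lambda>v. (principal_divisor \<Phi> g v + int n * E v) + (principal_divisor \<Phi> h v + E v))"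
      by (auto simp: set_mult_def translate_def div0_group_def)
    have "A = (\<lambda>v. principal_divisor \<Phi> (g * h) v + int (Suc n) * E v)"
      unfolding A by (simp add: principal_divisor_mult[OF gh] algebra_simps)
    then show "A \<in> translate (\<lambda>v. int (Suc n) * E v)"
      unfolding translate_def using gh by (intro image_eqI[of _ _ "g * h"]) simp_all
  next
    fix A assume "A \<in> translate (\<lambda>v. int (Suc n) * E v)"
    then obtain h where h: "h \<in> ?F" and A: "A = (\<lambda>v. principal_divisor \<Phi> h v + int (Suc n) * E v)"
      by (auto simp: translate_def)
    have "A = (\<lambda>v. (principal_divisor \<Phi> h v + int n * E v) + (principal_divisor \<Phi> 1 v + E v))"
      unfolding A by (simp add: principal_divisor_1 algebra_simps)
    moreover have "(1 :: 'k ff_closure) \<in> ?F"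
      by simp
    ultimately show "A \<in> translate (\<lambda>v. int n * E v) <#>\<^bsub>div0_group \<Phi>\<^esub> translate E"
      using h unfolding set_mult_def translate_def div0_group_def by fastforce
  qed
  finally show ?case .
qed

text \<open>The action takes the divisor of \<open>h\<close> to that of \<open>\<tau> h\<close>, and
  \<open>\<tau>\<close> permutes the nonzero functions.\<close>

lemma act_divisor_translate:
  assumes \<tau>: "\<tau> \<in> galois_lifts \<Phi>" and E: "act_divisor \<Phi> \<tau> E = E"
  shows "act_divisor \<Phi> \<tau> ` translate E = translate E"
proof -
  have "act_divisor \<Phi> \<tau> (\<lambda>v. principal_divisor \<Phi> h v + E v) = (\<lambda>v. principal_divisor \<Phi> (\<tau> h) v + E v)"
    if "h \<in> fun_field \<Phi> - {0}" for h
  proof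
    fix v
    show "act_divisor \<Phi> \<tau> (\<lambda>v. principal_divisor \<Phi> h v + E v) v = principal_divisor \<Phi> (\<tau> h) v + E v"
      using fun_cong[OF E, of v] that act_point_curve_points[OF \<tau>, of v]
      by (auto simp: act_divisor_def principal_divisor_def act_point_def)
  qed
  then have "act_divisor \<Phi> \<tau> ` translate E = (\<lambda>h v. principal_divisor \<Phi> h v + E v) ` \<tau> ` (fun_field \<Phi> - {0})"
    unfolding translate_def image_image by (intro image_cong) simp_all
  then show ?thesis
    by (simp add: galois_lift_image[OF \<tau>] translate_def)
qed

text \<open>The class of infinite order is that of \<open>P - Q\<close>, with \<open>Q\<close> the
  conjugate of \<open>P\<close>. A function whose divisor is a positive multiple of it is
  nonconstant and has zeros and poles only above \<open>x0\<close>, so it would yield a Pell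
  solution.\<close>

theorem positive_rank_jacobian:
  assumes "y0 \<noteq> 0" and "(to_ac y0)\<^sup>2 = poly g (to_ac x0)"
    and no_pell: "\<And>n A B. \<not> pell_solution g (to_ac x0) n A B"
  shows "positive_rank (jacobian_points \<Phi>)"
proof -
  obtain P where P: "is_point (to_ac x0) (to_ac y0) P"
    using point_exists assms(2) by blast
  obtain Q where Q: "is_point (to_ac x0) (to_ac (- y0)) Q"
    using point_exists[of "to_ac (- y0)"] assms(2) by auto
  note P_mem = is_pointD(1)[OF P] and Q_mem = is_pointD(1)[OF Q]
  \<comment> \<open>Otherwise \<open>y - y0\<close> and \<open>y + y0\<close> would both have
    positive order at \<open>P\<close>, and so would their difference, the nonzero constant
    \<open>- 2 y0\<close>.\<close>
  have "P \<noteq> Q"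
  proof
    assume "P = Q"
    then have "val_ge P 1 ((ff_poly [:- to_ac y0:] + ff_y \<Phi>) + ff_poly [:- 1:] * (ff_poly [:to_ac y0:] + ff_y \<Phi>))"
      using val_ge_mult[OF Q_mem val_ge_const[OF Q_mem, of "- 1"] is_pointD(4)[OF Q]]
      by (intro val_ge_add[OF P_mem is_pointD(4)[OF P]]) simp
    moreover have "ff_poly [:- 1:] = (- 1 :: 'k ff_closure)" "ff_poly [:- to_ac y0:] = - ff_poly [:to_ac y0:]"
      by (metis ff_poly_simps(2,5) one_pCons minus_pCons minus_zero)+
    then have "(ff_poly [:- to_ac y0:] + ff_y \<Phi>) + ff_poly [:- 1:] * (ff_poly [:to_ac y0:] + ff_y \<Phi>) =
        ff_poly (- ([:to_ac y0:] + [:to_ac y0:]))"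
      by (simp only: ff_poly_simps mult_minus_left mult_1) simp
    ultimately have "val_ge P 1 (ff_poly [:- (to_ac y0 + to_ac y0):])"
      by simp
    then show False
      using curve_points_const[OF P_mem, of "- (to_ac y0 + to_ac y0)"] assms(1)
      by (simp add: val_ge_def ff_const_eq mult_2[symmetric])
  qed
  define E :: "'k divisor" where "E v = (if v = P then 1 else if v = Q then - 1 else 0)" for v
  have E_supp: "{v. E v \<noteq> 0} = {P, Q}"
    by (auto simp: E_def)
  have "E \<in> carrier (div0_group \<Phi>)"
    using P_mem Q_mem \<open>P \<noteq> Q\<close> by (simp add: div0_group_def E_supp) (simp add: E_def)
  moreover have "principal_divisor \<Phi> ` (fun_field \<Phi> - {0}) #>\<^bsub>div0_group \<Phi>\<^esub> E = translate E"
    by (auto simp: r_coset_def translate_def div0_group_def)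
  ultimately have "translate E \<in> carrier (pic0_group \<Phi>)"
    unfolding pic0_group_def FactGroup_def RCOSETS_def by auto
  moreover have "act_divisor \<Phi> \<tau> ` translate E = translate E" if \<tau>: "\<tau> \<in> galois_lifts \<Phi>" for \<tau>
  proof (rule act_divisor_translate[OF \<tau>])
    have fixed: "act_point \<Phi> \<tau> P = P" "act_point \<Phi> \<tau> Q = Q"
      using act_point_rational[OF \<tau> _ P] act_point_rational[OF \<tau> _ Q] assms(1) by simp_all
    show "act_divisor \<Phi> \<tau> E = E"
    proof
      fix v
      show "act_divisor \<Phi> \<tau> E v = E v"
      proof (cases "v \<in> curve_points \<Phi>")
        case True
        then have "act_point \<Phi> \<tau> v = P \<longleftrightarrow> v = P" "act_point \<Phi> \<tau> v = Q \<longleftrightarrow> v = Q"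
          using act_point_inj[OF \<tau>] fixed P_mem Q_mem by metis+
        then show ?thesis
          using True by (simp add: act_divisor_def E_def)
      next
        case False
        then show ?thesis
          using P_mem Q_mem by (auto simp: act_divisor_def E_def)
      qed
    qed
  qed
  ultimately have "translate E \<in> carrier (jacobian_points \<Phi>)"
    by (simp add: jacobian_points_def)
  moreover have "translate E [^]\<^bsub>jacobian_points \<Phi>\<^esub> n \<noteq> \<one>\<^bsub>jacobian_points \<Phi>\<^esub>" if "n > 0" for n :: nat
  proof
    assume "translate E [^]\<^bsub>jacobian_points \<Phi>\<^esub> n = \<one>\<^bsub>jacobian_points \<Phi>\<^esub>"
    then have eq: "translate (\<lambda>v. int n * E v) = principal_divisor \<Phi> ` (fun_field \<Phi> - {0})"
      by (simp add: jacobian_points_power) (simp add: jacobian_points_def pic0_group_def FactGroup_def)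
    have "(\<lambda>v. int n * E v) \<in> translate (\<lambda>v. int n * E v)"
      unfolding translate_def by (intro image_eqI[of _ _ 1]) (simp_all add: principal_divisor_1)
    then obtain h where h: "h \<in> fun_field \<Phi>" "h \<noteq> 0" and div: "(\<lambda>v. int n * E v) = principal_divisor \<Phi> h"
      unfolding eq by auto
    have val: "v h = int n * E v" if "v \<in> curve_points \<Phi>" for v
      using fun_cong[OF div, of v] that by (simp add: principal_divisor_def)
    have "\<forall>v\<in>curve_points \<Phi>. v (ff_poly [:- to_ac x0, 1:]) \<le> 0 \<longrightarrow> v h = 0"
      using is_pointD(2)[OF P] is_pointD(2)[OF Q] by (auto simp: val E_def)
    moreover have "\<forall>v\<in>curve_points \<Phi>. - int n \<le> v h"
      by (auto simp: val E_def)
    ultimately obtain c where "h = ff_const c"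
      using pell_of_divisor[OF h] no_pell by blast
    then have "P h = 0"
      using curve_points_const[OF P_mem] by simp
    then show False
      using val[OF P_mem] that by (simp add: E_def)
  qed
  ultimately show ?thesis
    unfolding positive_rank_def by blast
qed

end

section \<open>Derivations\<close>

definition derivation :: "('a::comm_ring_1 \<Rightarrow> 'a) \<Rightarrow> bool" where
  "derivation d \<longleftrightarrow> (\<forall>a b. d (a + b) = d a + d b) \<and> (\<forall>a b. d (a * b) = d a * b + a * d b)"

lemma derivation_add: "derivation d \<Longrightarrow> d (a + b) = d a + d b"
  by (simp add: derivation_def)

lemma derivation_mult: "derivation d \<Longrightarrow> d (a * b) = d a * b + a * d b"
  by (simp add: derivation_def)

lemma derivation_0: "derivation d \<Longrightarrow> d 0 = 0"
  using derivation_mult[of d 0 0] by simp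

lemma derivation_1: "derivation d \<Longrightarrow> d 1 = 0"
  using derivation_mult[of d 1 1] by simp

lemma derivation_minus: "derivation d \<Longrightarrow> d (- a) = - d a"
  using derivation_add[of d a "- a"] derivation_0[of d] by (simp add: eq_neg_iff_add_eq_0 add.commute)

lemma derivation_power: "derivation d \<Longrightarrow> a * d (a ^ n) = of_nat n * a ^ n * d a"
  by (induction n) (simp_all add: derivation_1 derivation_mult algebra_simps)

lemma derivation_of_nat: "derivation d \<Longrightarrow> d (of_nat n) = 0"
  by (induction n) (simp_all add: derivation_0 derivation_1 derivation_add)

lemma derivation_of_int: "derivation d \<Longrightarrow> d (of_int n) = 0"
  by (cases n rule: int_cases2) (simp_all add: derivation_of_nat derivation_minus)

lemma derivation_divide:
  fixes d :: "'a::field \<Rightarrow> 'a"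
  assumes "derivation d" and "b \<noteq> 0"
  shows "d (a / b) = (d a * b - a * d b) / b\<^sup>2"
proof -
  have "d (a / b * b) = d (a / b) * b + a / b * d b"
    by (rule derivation_mult[OF assms(1)])
  then show ?thesis
    using assms(2) by (simp add: field_simps power2_eq_square)
qed

lemma derivation_of_rat:
  fixes d :: "'a::field_char_0 \<Rightarrow> 'a"
  assumes "derivation d"
  shows "d (of_rat r) = 0"
proof (cases r)
  case (Fract a b)
  then have "of_rat r = (of_int a / of_int b :: 'a)" "(of_int b :: 'a) \<noteq> 0"
    by (simp_all add: of_rat_rat)
  then show ?thesis
    using assms by (simp add: derivation_divide derivation_of_int)
qed

lemma derivation_poly:
  assumes "derivation d"
  shows "d (poly p x) = poly (map_poly d p) x + poly (pderiv p) x * d x"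
  by (induction p) (simp_all add: assms derivation_0 map_poly_pCons derivation_add derivation_mult pderiv_pCons algebra_simps)

lemma derivation_pderiv: "derivation pderiv"
  by (simp add: derivation_def pderiv_add pderiv_mult)

text \<open>The quotient rule gives the extension. Differentiating \<open>a b' = a' b\<close> shows
  that it does not depend on the chosen fraction.\<close>

lemma derivation_fract:
  fixes d :: "'a::idom \<Rightarrow> 'a"
  assumes d: "derivation d"
  shows "\<exists>d'::'a fract \<Rightarrow> 'a fract. derivation d' \<and> (\<forall>a. d' (to_fract a) = to_fract (d a))"
proof -
  define q where "q a b = Fract (d a * b - a * d b) (b * b)" for a b
  define d' where "d' x = (SOME z. \<exists>a b. b \<noteq> 0 \<and> x = Fract a b \<and> z = q a b)" for x
  have d': "d' (Fract a b) = q a b" if b: "b \<noteq> 0" for a b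
  proof -
    have "\<exists>z. \<exists>a' b'. b' \<noteq> 0 \<and> Fract a b = Fract a' b' \<and> z = q a' b'"
      using b by blast
    then have "\<exists>a' b'. b' \<noteq> 0 \<and> Fract a b = Fract a' b' \<and> d' (Fract a b) = q a' b'"
      unfolding d'_def by (rule someI_ex)
    then obtain a' b' where b': "b' \<noteq> 0" and eq: "Fract a b = Fract a' b'" and q: "d' (Fract a b) = q a' b'"
      by blast
    have ab: "a * b' = a' * b"
      using eq b b' by (simp add: eq_fract)
    then have "d (a * b') = d (a' * b)"
      by simp
    then have dab: "d a * b' = d a' * b + a' * d b - a * d b'"
      by (simp add: derivation_mult[OF d] algebra_simps)
    have "(d a * b - a * d b) * (b' * b') = (d a * b') * b * b' - (a * b') * d b * b'"
      by (simp add: algebra_simps)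
    also have "\<dots> = (d a' * b + a' * d b - a * d b') * b * b' - (a' * b) * d b * b'"
      by (simp only: dab ab)
    also have "\<dots> = d a' * b * b * b' - (a * b') * d b' * b"
      by (simp add: algebra_simps)
    also have "\<dots> = d a' * b * b * b' - (a' * b) * d b' * b"
      by (simp only: ab)
    also have "\<dots> = (d a' * b' - a' * d b') * (b * b)"
      by (simp add: algebra_simps)
    finally show ?thesis
      unfolding q q_def using b b' by (simp add: eq_fract)
  qed
  have "derivation d'"
    unfolding derivation_def
  proof (intro conjI allI)
    fix x y :: "'a fract"
    obtain a b where x: "x = Fract a b" "b \<noteq> 0"
      by (cases x)
    obtain a' b' where y: "y = Fract a' b'" "b' \<noteq> 0"
      by (cases y)
    show "d' (x + y) = d' x + d' y"
      using x y by (simp add: d' q_def eq_fract derivation_add[OF d] derivation_mult[OF d] algebra_simps)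
    show "d' (x * y) = d' x * y + x * d' y"
      using x y by (simp add: d' q_def eq_fract derivation_add[OF d] derivation_mult[OF d] algebra_simps)
  qed
  moreover have "d' (to_fract a) = to_fract (d a)" for a
    by (simp add: to_fract_def d' q_def derivation_1[OF d])
  ultimately show ?thesis
    by blast
qed

text \<open>A derivation kills the rationals, so \<open>p(x) = 0\<close> would give
  \<open>p'(x) d x = 0\<close>, against the induction hypothesis. Thus an element with nonzero
  derivative is transcendental over the rationals.\<close>

lemma poly_of_rat_nonzero:
  fixes d :: "'a::field_char_0 \<Rightarrow> 'a" and p :: "rat poly"
  assumes d: "derivation d" and x: "d x \<noteq> 0" and "p \<noteq> 0"
  shows "poly (map_poly of_rat p) x \<noteq> 0"
  using assms(3)
proof (induction "Polynomial.degree p" arbitrary: p)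
  case 0
  then obtain c where "p = [:c:]"
    by (metis degree_eq_zeroE)
  then show ?case
    using 0 by (simp add: map_poly_pCons)
next
  case (Suc k)
  have "Polynomial.degree (pderiv p) = k"
    using Suc.hyps(2) by (simp add: degree_pderiv)
  moreover have "pderiv p \<noteq> 0"
    using Suc.hyps(2) by (simp add: pderiv_eq_0_iff)
  ultimately have "poly (map_poly of_rat (pderiv p)) x \<noteq> 0"
    using Suc.hyps(1) by simp
  moreover have "map_poly d (map_poly of_rat p) = 0"
    by (intro poly_eqI) (simp add: coeff_map_poly derivation_0[OF d] derivation_of_rat[OF d])
  then have "d (poly (map_poly of_rat p) x) = poly (pderiv (map_poly of_rat p)) x * d x"
    by (simp add: derivation_poly[OF d])
  moreover have "pderiv (map_poly of_rat p) = (map_poly of_rat (pderiv p) :: 'a poly)"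
    by (intro poly_eqI) (simp add: coeff_map_poly coeff_pderiv of_rat_mult of_rat_add)
  ultimately have "d (poly (map_poly of_rat p) x) \<noteq> 0"
    using x by simp
  then show ?case
    using derivation_0[OF d] by auto
qed

text \<open>\<open>\<delta>\<close> applies \<open>d\<close> to the coefficients and sends
  \<open>x\<close> to \<open>l x\<close>. The Euler operator does not raise degrees, as the Pell
  argument requires.\<close>

lemma derivation_poly_ring:
  fixes d :: "'a::field_char_0 \<Rightarrow> 'a" and l :: 'a
  assumes d: "derivation d"
  defines "\<delta> \<equiv> \<lambda>p. map_poly d p + Polynomial.smult l (pCons 0 (pderiv p))"
  shows "\<delta> (p + q) = \<delta> p + \<delta> q" and "\<delta> (p * q) = \<delta> p * q + p * \<delta> q"
    and "Polynomial.degree (\<delta> p) \<le> Polynomial.degree p"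
proof -
  show "\<delta> (p + q) = \<delta> p + \<delta> q"
    by (simp add: \<delta>_def map_poly_add_additive derivation_add[OF d] pderiv_add smult_add_right)
  have "map_poly d (p * q) = map_poly d p * q + p * map_poly d q"
    by (intro poly_eqI) (simp add: coeff_map_poly derivation_0[OF d] coeff_mult
        additive_sum[of d, OF derivation_add[OF d]] derivation_mult[OF d] sum.distrib)
  moreover have "pCons 0 (pderiv r) = [:0, 1:] * pderiv r" for r :: "'a poly"
    by simp
  ultimately show "\<delta> (p * q) = \<delta> p * q + p * \<delta> q"
    unfolding \<delta>_def by (simp only: pderiv_mult) (simp add: algebra_simps smult_add_right)
  have "Polynomial.degree (pCons 0 (pderiv p)) \<le> Polynomial.degree p"
    by (cases "pderiv p = 0") (auto simp: degree_pderiv pderiv_eq_0_iff)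
  then show "Polynomial.degree (\<delta> p) \<le> Polynomial.degree p"
    unfolding \<delta>_def using map_poly_degree_leq[of d p] degree_smult_le order_trans
    by (intro degree_add_le) blast+
qed

section \<open>Positive rank from a derivation\<close>

lemma ff_y_square_curve:
  fixes a :: "'k::field_char_0"
  assumes "a \<noteq> 0"
  shows "(ff_y (square_curve a f))\<^sup>2 = ff_poly (ac_poly (Polynomial.smult (1 / a) f))"
proof -
  let ?g = "Polynomial.smult (1 / a) f"
  have "f = [:a:] * ?g"
    using assms by simp
  then have f: "ff_poly (ac_poly f) = ff_poly [:to_ac a:] * ff_poly (ac_poly ?g)"
    by (metis ac_poly_simps(4) ff_poly_simps(6) map_poly_pCons map_poly_0 to_ac_0)
  have "poly (map_poly (\<lambda>p. to_ac (to_fract (ac_poly p))) (square_curve a f)) y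
      = ff_poly [:to_ac a:] * y\<^sup>2 - ff_poly (ac_poly f)" for y
    by (simp add: square_curve_def map_poly_pCons ff_poly_def power2_eq_square algebra_simps)
  then have root: "poly (map_poly (\<lambda>p. to_ac (to_fract (ac_poly p))) (square_curve a f)) y = 0
      \<longleftrightarrow> y\<^sup>2 = ff_poly (ac_poly ?g)" for y
    using assms unfolding f by simp
  obtain y where "y\<^sup>2 = ff_poly (ac_poly ?g)"
    using nth_root_exists[of 2 "ff_poly (ac_poly ?g)"] by auto
  then show ?thesis
    unfolding ff_y_def root by (rule someI)
qed

text \<open>\<open>l\<close> and \<open>\<mu>\<close> are the weights of \<open>x\<close> and
  \<open>y\<close>, and \<open>d x0 \<noteq> l x0\<close> says that \<open>\<delta> (x - x0)\<close>
  does not vanish at \<open>x0\<close>. Since \<open>d\<close> lives on the ground field, a Pell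
  solution is first descended there.\<close>

theorem positive_rank_square_curve:
  fixes d :: "'k::field_char_0 \<Rightarrow> 'k"
  assumes d: "derivation d" and a: "a \<noteq> 0" and deg: "Polynomial.degree f \<ge> 3"
    and sqf: "rsquarefree (ac_poly f)" and pt: "a * y0\<^sup>2 = poly f x0" "y0 \<noteq> 0"
    and g: "g = Polynomial.smult (1 / a) f"
    and \<delta>: "map_poly d g + Polynomial.smult l (pCons 0 (pderiv g)) = Polynomial.smult (2 * \<mu>) g"
    and x0: "d x0 \<noteq> l * x0"
  shows "positive_rank (jacobian_points (square_curve a f))"
proof -
  have deg_g: "Polynomial.degree g \<ge> 3"
    using deg a by (simp add: g)
  have sqf_g: "rsquarefree (ac_poly g)"
    using sqf a by (simp add: rsquarefree_def g order_smult)
  have pt_g: "y0\<^sup>2 = poly g x0"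
    using pt(1) a by (simp add: g field_simps)
  interpret hyperelliptic "square_curve a f" "ac_poly g"
    using ff_y_square_curve[OF a, of f] sqf_g deg_g a unfolding g by unfold_locales simp_all
  have no_pell: "\<not> pell_solution (ac_poly g) (to_ac x0) n A B" for n A B
  proof
    assume "pell_solution (ac_poly g) (to_ac x0) n A B"
    moreover have "Q = 0" if "P\<^sup>2 = g * Q\<^sup>2" for P Q
    proof -
      have "(ac_poly P)\<^sup>2 = ac_poly g * (ac_poly Q)\<^sup>2"
        unfolding ac_poly_power[symmetric] ac_poly_simps(4)[symmetric] by (simp add: that)
      then have "ac_poly Q = 0"
        using norm_eq_0D by blast
      then show ?thesis
        by (metis ac_poly_simps(9) map_poly_0)
    qed
    ultimately obtain n A B where sol: "pell_solution g x0 n A B"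
      using pell_descent[OF pt(2) pt_g] deg_g by (metis less_le_trans zero_less_numeral)
    moreover have "poly g x0 \<noteq> 0"
      using pt_g pt(2) by auto
    ultimately obtain n A B where sol: "pell_solution g x0 n A B" "poly A x0 \<noteq> 0"
      using pell_solution_reduce deg_g by (metis less_le_trans zero_less_numeral)
    have "poly (map_poly d [:- x0, 1:] + Polynomial.smult l (pCons 0 (pderiv [:- x0, 1:]))) x0 = - d x0 + l * x0"
      by (simp add: map_poly_pCons derivation_0[OF d] derivation_1[OF d] derivation_minus[OF d] pderiv_pCons)
    then show False
      using x0 by (intro pell_no_solution_derivation[OF derivation_poly_ring[OF d, where l = l] \<delta> deg_g _ sol]) simp
  qed
  have "(to_ac y0)\<^sup>2 = poly (ac_poly g) (to_ac x0)"
    by (simp add: pt_g flip: to_ac_power)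
  then show ?thesis
    using positive_rank_jacobian pt(2) no_pell by blast
qed

section \<open>Points on the twists\<close>

lemma to_ac_of_rat: "to_ac (of_rat r :: 'a::field_char_0) = of_rat r"
  by (cases r) (simp add: of_rat_rat)

text \<open>A common factor of \<open>f\<close> and \<open>f'\<close> would have a complex root, so
  they satisfy a Bezout identity over the rationals. That identity persists in every field of
  characteristic zero.\<close>

lemma rsquarefree_of_rat_transfer:
  fixes f :: "rat poly"
  assumes "rsquarefree (map_poly of_rat f :: complex poly)"
  shows "rsquarefree (map_poly of_rat f :: 'a::field_char_0 poly)"
proof -
  have hom: "map_poly of_rat (p * q) = (map_poly of_rat p * map_poly of_rat q :: 'b::field_char_0 poly)"
    "map_poly of_rat (p + q) = (map_poly of_rat p + map_poly of_rat q :: 'b poly)"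
    "map_poly of_rat (pderiv p) = pderiv (map_poly of_rat p :: 'b poly)" for p q
    by (simp_all add: map_poly_mult_hom map_poly_add_additive of_rat_add of_rat_mult)
      (intro poly_eqI, simp add: coeff_map_poly coeff_pderiv of_rat_mult of_rat_add)
  have "f \<noteq> 0"
    using assms by (auto simp: rsquarefree_def)
  define h where "h = gcd f (pderiv f)"
  have "h \<noteq> 0"
    using \<open>f \<noteq> 0\<close> by (simp add: h_def)
  have "Polynomial.degree h = 0"
  proof (rule ccontr)
    assume "Polynomial.degree h \<noteq> 0"
    then have "Polynomial.degree (map_poly of_rat h :: complex poly) > 0"
      by (simp add: degree_map_poly)
    then obtain z where z: "poly (map_poly of_rat h :: complex poly) z = 0"
      using alg_closed_imp_poly_has_root by blast
    obtain p q where p: "f = h * p" and q: "pderiv f = h * q"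
      unfolding h_def using gcd_dvd1 gcd_dvd2 by (meson dvdE)
    have "poly (map_poly of_rat f) z = 0"
      unfolding p hom(1) using z by simp
    moreover have "poly (pderiv (map_poly of_rat f)) z = 0"
      unfolding hom(3)[symmetric] q hom(1) using z by simp
    ultimately show False
      using assms by (simp add: rsquarefree_roots)
  qed
  then obtain c where c: "h = [:c:]" "c \<noteq> 0"
    using \<open>h \<noteq> 0\<close> by (metis degree_eq_zeroE pCons_0_0)
  obtain p q where "p * f + q * pderiv f = h"
    unfolding h_def using bezout_coefficients_fst_snd by blast
  then have "map_poly of_rat p * map_poly of_rat f + map_poly of_rat q * pderiv (map_poly of_rat f) = ([:of_rat c:] :: 'a poly)"
    unfolding hom[symmetric] by (simp add: c map_poly_pCons)
  then have "poly (map_poly of_rat p * map_poly of_rat f + map_poly of_rat q * pderiv (map_poly of_rat f)) x = (of_rat c :: 'a)" for x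
    by simp
  then have "poly (map_poly of_rat p) x * poly (map_poly of_rat f) x
      + poly (map_poly of_rat q) x * poly (pderiv (map_poly of_rat f)) x \<noteq> (0 :: 'a)" for x
    using c(2) by simp
  then show ?thesis
    unfolding rsquarefree_roots by (metis add_0 mult_zero_right)
qed

lemma rsquarefree_monom_plus_const:
  fixes a :: "'a::field_char_0"
  assumes "a \<noteq> 0" and "m \<ge> 2"
  shows "rsquarefree (Polynomial.monom 1 m + [:a:])"
  unfolding rsquarefree_roots using assms
  by (auto simp: poly_monom pderiv_add pderiv_monom pderiv_pCons power_0_left)

lemma degree_monom_plus_const:
  fixes a :: "'a::field"
  assumes "m > 0"
  shows "Polynomial.degree (Polynomial.monom 1 m + [:a:]) = m"
  using assms by (subst degree_add_eq_left) (simp_all add: degree_monom_eq)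

text \<open>Here \<open>x\<close> has weight \<open>0\<close>: since \<open>d\<close> kills the
  coefficients of \<open>f\<close>, it multiplies \<open>f / D\<close> by
  \<open>- d D / D\<close>.\<close>

theorem positive_rank_quadratic_twist:
  fixes d :: "'k::field_char_0 \<Rightarrow> 'k" and f :: "rat poly"
  assumes d: "derivation d" and "Polynomial.degree f \<ge> 3"
    and "rsquarefree (map_poly of_rat f :: complex poly)"
    and D: "D \<noteq> 0" "D * y0\<^sup>2 = poly (map_poly of_rat f) x0" and "y0 \<noteq> 0" and "d x0 \<noteq> 0"
  shows "positive_rank (jacobian_points (square_curve D (map_poly of_rat f)))"
proof (rule positive_rank_square_curve[OF d D(1) _ _ D(2) \<open>y0 \<noteq> 0\<close> refl])
  show "Polynomial.degree (map_poly of_rat f :: 'k poly) \<ge> 3"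
    using assms(2) by (simp add: degree_map_poly)
  have "ac_poly (map_poly of_rat f :: 'k poly) = map_poly of_rat f"
    by (simp add: map_poly_map_poly o_def to_ac_of_rat)
  then show "rsquarefree (ac_poly (map_poly of_rat f :: 'k poly))"
    using rsquarefree_of_rat_transfer[OF assms(3)] by simp
  show "map_poly d (Polynomial.smult (1 / D) (map_poly of_rat f)) +
      Polynomial.smult 0 (pCons 0 (pderiv (Polynomial.smult (1 / D) (map_poly of_rat f)))) =
      Polynomial.smult (2 * (- d D / (2 * D))) (Polynomial.smult (1 / D) (map_poly of_rat f))"
    using D(1) by (intro poly_eqI) (simp add: coeff_map_poly derivation_0[OF d] derivation_divide[OF d]
        derivation_of_rat[OF d] power2_eq_square)
  show "d x0 \<noteq> 0 * x0"
    using assms(7) by simp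
qed

text \<open>With weight \<open>d D / (m D)\<close> for \<open>x\<close>, both \<open>x^m\<close> and
  \<open>b D\<close> are multiplied by \<open>d D / D\<close>. For \<open>x0 \<noteq> 0\<close> the
  last hypothesis says that \<open>d\<close> does not kill \<open>x0^m / D\<close>.\<close>

theorem positive_rank_higher_twist:
  fixes d :: "'k::field_char_0 \<Rightarrow> 'k"
  assumes d: "derivation d" and "m \<ge> 3" and "d b = 0" "b \<noteq> 0" "D \<noteq> 0"
    and pt: "y0\<^sup>2 = x0 ^ m + b * D" and "y0 \<noteq> 0" and "of_nat m * D * d x0 \<noteq> x0 * d D"
  shows "positive_rank (jacobian_points (square_curve 1 (Polynomial.monom 1 m + [:b * D:])))"
proof (rule positive_rank_square_curve[OF d _ _ _ _ \<open>y0 \<noteq> 0\<close> refl])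
  show "Polynomial.degree (Polynomial.monom 1 m + [:b * D:]) \<ge> 3"
    using assms(2) by (simp add: degree_monom_plus_const)
  have "ac_poly (Polynomial.monom 1 m + [:b * D:]) = Polynomial.monom 1 m + [:to_ac (b * D):]"
    by (simp add: map_poly_pCons map_poly_monom)
  then show "rsquarefree (ac_poly (Polynomial.monom 1 m + [:b * D:]))"
    using assms(2,4,5) rsquarefree_monom_plus_const[of "to_ac (b * D)" m] by simp
  show "1 * y0\<^sup>2 = poly (Polynomial.monom 1 m + [:b * D:]) x0"
    using pt by (simp add: poly_monom)
  have "map_poly d (Polynomial.monom 1 m + [:b * D:]) = [:b * d D:]"
    using assms(3) by (simp add: map_poly_add_additive derivation_add[OF d] map_poly_monom map_poly_pCons
        derivation_0[OF d] derivation_1[OF d] derivation_mult[OF d])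
  moreover have "pCons 0 (pderiv (Polynomial.monom 1 m + [:b * D:])) = Polynomial.monom (of_nat m) m"
    using assms(2) by (simp add: pderiv_add pderiv_monom pderiv_pCons flip: monom_Suc)
  ultimately show "map_poly d (Polynomial.smult (1 / 1) (Polynomial.monom 1 m + [:b * D:])) +
      Polynomial.smult (d D / (of_nat m * D))
        (pCons 0 (pderiv (Polynomial.smult (1 / 1) (Polynomial.monom 1 m + [:b * D:])))) =
      Polynomial.smult (2 * (d D / (2 * D))) (Polynomial.smult (1 / 1) (Polynomial.monom 1 m + [:b * D:]))"
    using assms(2,5) by (simp add: smult_monom smult_add_right)
  show "d x0 \<noteq> d D / (of_nat m * D) * x0"
    using assms(2,5,8) by (simp add: field_simps)
qed simp

section \<open>Choice of the common twist\<close>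

text \<open>This keeps the right-hand side of the conic below nonzero: \<open>k = 1\<close> works
  unless \<open>b = c\<close>, and then \<open>k = 2\<close> does.\<close>

lemma twist_parameter_exists:
  fixes b c :: int
  assumes "b \<noteq> 0" and "m > 0"
  shows "\<exists>k::nat. k > 0 \<and> b \<noteq> c * int k ^ (2 * m)"
proof (cases "b = c")
  case True
  have "(2::int) ^ (2 * m) > 1"
    using assms(2) by (intro one_less_power) simp_all
  then show ?thesis
    using assms True by (intro exI[of _ 2]) simp
next
  case False
  then show ?thesis
    by (intro exI[of _ 1]) simp
qed

text \<open>
  With \<open>F = f(W)\<close> and \<open>D = F T\<^bsup>m-1\<^esup>\<close>, the point with \<open>x = W\<close> lies on the quadratic twist, and
  the points with \<open>x = k\<^sup>2 T\<close> and \<open>x = T\<close> lie on the higher twists as soon as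
  \<open>p\<^sup>2 = k\<^bsup>2m\<^esup> T + b F\<close> and \<open>q\<^sup>2 = T + c F\<close>. Eliminating \<open>T\<close> leaves the split conic
  \<open>p\<^sup>2 - (k\<^sup>m q)\<^sup>2 = (b - c k\<^bsup>2m\<^esup>) F\<close>, of which \<open>p\<close> and \<open>q\<close> below are a point.
\<close>

theorem simultaneous_twist_exists:
  fixes d :: "'k::field_char_0 \<Rightarrow> 'k" and f :: "rat poly" and b c :: int
  assumes d: "derivation d" and W: "d W \<noteq> 0"
    and "Polynomial.degree f \<ge> 3" and "rsquarefree (map_poly of_rat f :: complex poly)"
    and "m \<ge> 3" and "odd m" and "b \<noteq> 0" and "c \<noteq> 0"
  shows "\<exists>D::'k. D \<noteq> 0 \<and>
    positive_rank (jacobian_points (square_curve D (map_poly of_rat f))) \<and>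
    positive_rank (jacobian_points (square_curve 1 (Polynomial.monom 1 m + [:of_int b * D:]))) \<and>
    positive_rank (jacobian_points (square_curve 1 (Polynomial.monom 1 m + [:of_int c * D:])))"
proof -
  obtain k :: nat where k: "k > 0" "b \<noteq> c * int k ^ (2 * m)"
    using twist_parameter_exists[OF \<open>b \<noteq> 0\<close>, of m c] \<open>m \<ge> 3\<close> by auto
  obtain j where j: "m = 2 * j + 1"
    using \<open>odd m\<close> by (elim oddE)
  define s :: rat where "s = of_nat k ^ m"
  define e :: rat where "e = of_int b - of_int c * s\<^sup>2"
  have "s \<noteq> 0"
    using k(1) by (simp add: s_def)
  have "e = of_int (b - c * int k ^ (2 * m))"
    by (simp add: e_def s_def power_mult[symmetric] mult.commute)
  then have "e \<noteq> 0"
    using k(2) by (simp only: of_int_eq_0_iff)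
  define S E :: 'k where "S = of_rat s" and "E = of_rat e"
  have "S \<noteq> 0" "E \<noteq> 0"
    using \<open>s \<noteq> 0\<close> \<open>e \<noteq> 0\<close> by (simp_all add: S_def E_def)
  have S: "S = of_nat k ^ m" and E: "E = of_int b - of_int c * S\<^sup>2"
    by (simp_all add: S_def E_def s_def e_def of_rat_diff of_rat_mult of_rat_power)
  define F where "F = poly (map_poly of_rat f) W"
  \<comment> \<open>The factors \<open>p + S q\<close> and \<open>p - S q\<close> of the conic are
    set to \<open>E F\<close> and \<open>1\<close>.\<close>
  define p where "p = (E * F + 1) / 2"
  define q where "q = (E * F - 1) / (2 * S)"
  define T where "T = q\<^sup>2 - of_int c * F"
  \<comment> \<open>The exponent \<open>2 j = m - 1\<close> is even, so \<open>D\<close> and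
    \<open>F\<close> differ by a square, and \<open>T^m + c D = T^(2 j) (T + c F)\<close>.\<close>
  define D where "D = F * T ^ (2 * j)"
  have pT: "p\<^sup>2 = S\<^sup>2 * T + of_int b * F"
  proof -
    have "p\<^sup>2 - (S * q)\<^sup>2 = E * F"
      using \<open>S \<noteq> 0\<close> by (simp add: p_def q_def power2_eq_square field_simps)
    then show ?thesis
      by (simp add: E T_def power_mult_distrib algebra_simps)
  qed
  have const: "d (of_rat r) = 0" for r
    by (rule derivation_of_rat[OF d])
  have "map_poly d (map_poly of_rat f) = 0"
    by (intro poly_eqI) (simp add: coeff_map_poly derivation_0[OF d] const)
  then have "d F = poly (pderiv (map_poly of_rat f)) W * d W"
    by (simp add: F_def derivation_poly[OF d])
  also have "pderiv (map_poly of_rat f) = (map_poly of_rat (pderiv f) :: 'k poly)"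
    by (intro poly_eqI) (simp add: coeff_map_poly coeff_pderiv of_rat_mult of_rat_add)
  finally have "d F = poly (map_poly of_rat (pderiv f)) W * d W" .
  moreover have "pderiv f \<noteq> 0"
    using assms(3) by (simp add: pderiv_eq_0_iff)
  ultimately have dF: "d F \<noteq> 0"
    using poly_of_rat_nonzero[OF d W] W by simp
  \<comment> \<open>As \<open>d F \<noteq> 0\<close>, \<open>F\<close> is transcendental over the
    rationals, so the elements below are nonzero once they are written as nonzero rational
    polynomials in \<open>F\<close>.\<close>
  note transcendental = poly_of_rat_nonzero[OF d dF]
  have "F \<noteq> 0"
    using transcendental[of "[:0, 1:]"] by (simp add: map_poly_pCons)
  have "p \<noteq> 0" "q \<noteq> 0"
    using transcendental[of "[:1, e:]"] transcendental[of "[:- 1, e:]"] \<open>S \<noteq> 0\<close>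
    by (simp_all add: map_poly_pCons p_def q_def E_def of_rat_minus mult.commute add.commute)
  define \<alpha> \<beta> \<gamma> :: rat where "\<alpha> = e\<^sup>2 / (4 * s\<^sup>2)" and "\<beta> = - e / (2 * s\<^sup>2) - of_int c" and "\<gamma> = 1 / (4 * s\<^sup>2)"
  have "\<alpha> \<noteq> 0"
    using \<open>e \<noteq> 0\<close> \<open>s \<noteq> 0\<close> by (simp add: \<alpha>_def)
  have T: "T = of_rat \<alpha> * F\<^sup>2 + of_rat \<beta> * F + of_rat \<gamma>"
    using \<open>S \<noteq> 0\<close> unfolding T_def q_def \<alpha>_def \<beta>_def \<gamma>_def
    by (simp add: of_rat_divide of_rat_mult of_rat_diff of_rat_minus of_rat_power S_def[symmetric] E_def[symmetric]
        power2_eq_square field_simps)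
  have "T \<noteq> 0"
    using transcendental[of "[:\<gamma>, \<beta>, \<alpha>:]"] \<open>\<alpha> \<noteq> 0\<close>
    by (simp add: map_poly_pCons T power2_eq_square algebra_simps)
  have "D \<noteq> 0"
    using \<open>F \<noteq> 0\<close> \<open>T \<noteq> 0\<close> by (simp add: D_def)
  have dT: "d T = (2 * of_rat \<alpha> * F + of_rat \<beta>) * d F"
    by (simp add: T derivation_add[OF d] derivation_mult[OF d] const power2_eq_square algebra_simps)
  \<comment> \<open>The term \<open>\<beta> F\<close> of \<open>T\<close> drops out. Nonvanishing of
    this Wronskian means that \<open>d\<close> does not kill \<open>T / F\<close>.\<close>
  have "F * d T - T * d F = (of_rat \<alpha> * F\<^sup>2 - of_rat \<gamma>) * d F"
    unfolding dT by (simp add: T power2_eq_square algebra_simps)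
  moreover have "of_rat \<alpha> * F\<^sup>2 - of_rat \<gamma> \<noteq> 0"
    using transcendental[of "[:- \<gamma>, 0, \<alpha>:]"] \<open>\<alpha> \<noteq> 0\<close>
    by (simp add: map_poly_pCons of_rat_minus power2_eq_square algebra_simps)
  ultimately have wronskian: "F * d T - T * d F \<noteq> 0"
    using dF by simp
  have TD: "T * d D = T ^ (2 * j) * (T * d F + of_nat (2 * j) * F * d T)"
  proof -
    have "T * d D = T * d F * T ^ (2 * j) + F * (T * d (T ^ (2 * j)))"
      by (simp add: D_def derivation_mult[OF d] algebra_simps)
    then show ?thesis
      unfolding derivation_power[OF d] by (simp add: algebra_simps)
  qed
  \<comment> \<open>For \<open>x0 = u T\<close> the condition of the higher twists reduces to the
    Wronskian because \<open>m - 2 j = 1\<close>. It is used for \<open>u = k^2\<close> and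
    \<open>u = 1\<close>.\<close>
  have generic: "of_nat m * D * d (u * T) \<noteq> u * T * d D" if "u \<noteq> 0" "d u = 0" for u
  proof -
    have "of_nat m * D * d (u * T) - u * T * d D = u * (of_nat m * D * d T - T * d D)"
      using that(2) by (simp add: derivation_mult[OF d] algebra_simps)
    also have "\<dots> = u * T ^ (2 * j) * (F * d T - T * d F)"
      unfolding TD j by (simp add: D_def algebra_simps)
    finally show ?thesis
      using that(1) \<open>T \<noteq> 0\<close> wronskian by auto
  qed
  have "positive_rank (jacobian_points (square_curve D (map_poly of_rat f)))"
  proof (rule positive_rank_quadratic_twist[OF d assms(3,4) \<open>D \<noteq> 0\<close> _ _ W])
    show "D * (1 / T ^ j)\<^sup>2 = poly (map_poly of_rat f) W"
      using \<open>T \<noteq> 0\<close> by (simp add: D_def F_def power_divide power_mult[symmetric] mult.commute)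
  qed (use \<open>T \<noteq> 0\<close> in simp)
  moreover have "positive_rank (jacobian_points (square_curve 1 (Polynomial.monom 1 m + [:of_int b * D:])))"
  proof (rule positive_rank_higher_twist[OF d \<open>m \<ge> 3\<close> _ _ \<open>D \<noteq> 0\<close>])
    have "((of_nat k)\<^sup>2 * T) ^ m = S\<^sup>2 * T * T ^ (2 * j)"
      unfolding S by (simp add: power_mult_distrib j power_mult[symmetric] power_add algebra_simps power2_eq_square)
    then show "(p * T ^ j)\<^sup>2 = ((of_nat k)\<^sup>2 * T) ^ m + of_int b * D"
      by (simp add: power_mult_distrib pT D_def power_mult[symmetric] mult.commute algebra_simps)
    show "of_nat m * D * d ((of_nat k)\<^sup>2 * T) \<noteq> (of_nat k)\<^sup>2 * T * d D"
      using k(1) derivation_of_nat[OF d, of "k\<^sup>2"] by (intro generic) simp_all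
  qed (use \<open>b \<noteq> 0\<close> \<open>p \<noteq> 0\<close> \<open>T \<noteq> 0\<close> derivation_of_int[OF d] in simp_all)
  moreover have "positive_rank (jacobian_points (square_curve 1 (Polynomial.monom 1 m + [:of_int c * D:])))"
  proof (rule positive_rank_higher_twist[OF d \<open>m \<ge> 3\<close> _ _ \<open>D \<noteq> 0\<close>])
    have "q\<^sup>2 = T + of_int c * F"
      by (simp add: T_def)
    then show "(q * T ^ j)\<^sup>2 = T ^ m + of_int c * D"
      by (simp add: power_mult_distrib D_def j power_mult[symmetric] mult.commute algebra_simps)
    show "of_nat m * D * d T \<noteq> T * d D"
      using generic[of 1] derivation_1[OF d] by simp
  qed (use \<open>c \<noteq> 0\<close> \<open>q \<noteq> 0\<close> \<open>T \<noteq> 0\<close> derivation_of_int[OF d] in simp_all)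
  ultimately show ?thesis
    using \<open>D \<noteq> 0\<close> by blast
qed

theorem theorem3p1:
  fixes f :: "rat poly" and m :: nat and b c :: int
  assumes "Polynomial.degree f \<ge> 3"
    and "rsquarefree (map_poly of_rat f :: complex poly)"
    and "m \<ge> 3" and "odd m"
    and "b \<noteq> 0" and "c \<noteq> 0"
  shows "\<exists>D::ratfun3. D \<noteq> 0 \<and>
    positive_rank (jacobian_points (square_curve D (map_poly of_rat f))) \<and>
    positive_rank (jacobian_points (square_curve 1 (Polynomial.monom 1 m + [:of_int b * D:]))) \<and>
    positive_rank (jacobian_points (square_curve 1 (Polynomial.monom 1 m + [:of_int c * D:])))"
proof -
  \<comment> \<open>\<open>d\<close> is the partial derivative in the outermost variable
    \<open>w\<close>, and \<open>w\<close> itself serves as \<open>W\<close>, the abscissa of the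
    point on the quadratic twist.\<close>
  obtain d :: "ratfun3 \<Rightarrow> ratfun3" where d: "derivation d" "\<And>a. d (to_fract a) = to_fract (pderiv a)"
    using derivation_fract[OF derivation_pderiv] by blast
  have "d (to_fract [:0, 1:]) \<noteq> 0"
    by (simp add: d(2) pderiv_pCons)
  then show ?thesis
    using simultaneous_twist_exists[OF d(1)] assms by blast
qed

end
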